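(* In the regression setting and with the notation given in the context, let $\delta_1,\delta_2$ be two regression procedures with estimators $\widehat f_{n,1},\widehat f_{n,2}$ ($n\ge 1$) of $f$, and suppose that $\widehat f_{n,1}$ converges exactly at rate $\{p_n\}$ in probability and $\widehat f_{n,2}$ converges exactly at rate $\{q_n\}$ in probability, both under the $L_2$ loss. Assume: (0) there is a constant $\overline\sigma^2>0$ such that $E(\varepsilon_i^2\mid X_i)\le\overline\sigma^2$ almost surely for all $i\ge1$; (1) there is a sequence of positive numbers $\{A_n\}$ such that $\|f-\widehat f_{n,j}\|_\infty=O_p(A_n)$ for $j=1,2$; (2) under the $L_2$ loss, either $\delta_1$ is asymptotically better than $\delta_2$, or $\delta_2$ is asymptotically better than $\delta_1$; (3) there is a sequence of positive numbers $\{M_n\}$ such that $\|f-\widehat f_{n,j}\|_4/\|f-\widehat f_{n,j}\|_2=O_p(M_n)$ for $j=1,2$. Suppose the data splitting $n=n_1+n_2$ (with $n_1=n_1(n)$, $n_2=n_2(n)$) satisfies, as $n\to\infty$: (a) $n_1\to\infty$ and $n_2\to\infty$; (b) $n_2M_{n_1}^{-4}\to\infty$; (c) $\sqrt{n_2}\,\max(p_{n_1},q_{n_1})/(1+A_{n_1})\to\infty$. Then the delete-$n_2$ cross validation is consistent, that is, $P(\widehat I_n\ne I^* )\to0$ as $n\to\infty$.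
   Context: Setting: $Y_i=f(X_i)+\varepsilon_i$, $i\ge 1$, where $(X_i,Y_i)$ are independent observations, the $X_i$ are i.i.d. with (unknown) distribution $P_X$ on a Borel set $\mathcal X\subset\mathbb R^d$, $d\ge1$, $f$ is the true regression function, and $E(\varepsilon_i\mid X_i)=0$, $E(\varepsilon_i^2\mid X_i)<\infty$ almost surely. The errors need not be identically distributed. A regression procedure $\delta_j$ produces, from a sample $(X_i,Y_i)_{i=1}^n$ of any size $n$, an estimator $\widehat f_{n,j}$ of $f$ (a function on $\mathcal X$). Norms: $\|g\|_q=\left(\int|g(x)|^qP_X(dx)\right)^{1/q}$ for $1\le q<\infty$, and $\|g\|_\infty=\operatorname{ess\,sup}|g|$ (with respect to $P_X$). The $L_2$ loss is $L(f,\widehat f)=\|f-\widehat f\|_2$. Asymptotically better: under a loss $L$, a procedure with estimators $\widehat\theta_{n,1}$ is asymptotically better than one with estimators $\widehat\theta_{n,2}$ if for every $0<\epsilon<1$ there is a constant $c_\epsilon>0$ such that for all large enough $n$, $P\big(L(\theta,\widehat\theta_{n,2})\ge(1+c_\epsilon)L(\theta,\widehat\theta_{n,1})\big)\ge1-\epsilon$. Exact rate: for a sequence $\{a_n\}$ of positive numbers approaching zero, $\{\widehat\theta_n\}$ converges exactly at rate $\{a_n\}$ in probability under $L$ if $L(\theta,\widehat\theta_n)=O_p(a_n)$ and for every $0<\epsilon<1$ there is $c_\epsilon>0$ such that $P(L(\theta,\widehat\theta_n)\ge c_\epsilon a_n)\ge1-\epsilon$ for all large enough $n$. Delete-$n_2$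 cross validation: with $n_2=n-n_1$, apply $\delta_1,\delta_2$ to the estimation data $(X_i,Y_i)_{i=1}^{n_1}$ to obtain $\widehat f_{n_1,1},\widehat f_{n_1,2}$, and compute $\mathrm{CV}(\widehat f_{n_1,j})=\sum_{i=n_1+1}^n(Y_i-\widehat f_{n_1,j}(X_i))^2$, $j=1,2$. Let $\widehat I_n=1$ if $\mathrm{CV}(\widehat f_{n_1,1})\le\mathrm{CV}(\widehat f_{n_1,2})$ and $\widehat I_n=2$ otherwise. Let $I^*=1$ if $\delta_1$ is asymptotically better than $\delta_2$ under the $L_2$ loss, and $I^*=2$ if $\delta_2$ is asymptotically better than $\delta_1$. *)

theory Defs
  imports "HOL-Probability.Probability"
begin

abbreviation borel_on :: "'a::topological_space set \<Rightarrow> 'a measure" where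
  "borel_on \<X> \<equiv> restrict_space borel \<X>"

(* Observations are indexed by i \<ge> 1; values at index 0 are irrelevant. The conditional
   expectations are taken given sigma(X_i). Integrability of the errors is not assumed
   separately: the conditional second moment is finite almost surely, so both parts of
   real_cond_exp are finite almost surely. *)
locale regression_model = prob_space \<P>
  for \<P> :: "'w measure" +
  fixes \<X> :: "(real ^ 'd) set"
    and PX :: "(real ^ 'd) measure"
    and X :: "nat \<Rightarrow> 'w \<Rightarrow> real ^ 'd"
    and Y :: "nat \<Rightarrow> 'w \<Rightarrow> real"
    and \<epsilon> :: "nat \<Rightarrow> 'w \<Rightarrow> real"
    and f :: "real ^ 'd \<Rightarrow> real"
  assumes borel_\<X>: "\<X> \<in> sets borel"
    and measurable_f: "f \<in> borel_measurable (borel_on \<X>)"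
    and measurable_X: "\<And>i. 1 \<le> i \<Longrightarrow> X i \<in> measurable \<P> (borel_on \<X>)"
    and measurable_\<epsilon>: "\<And>i. 1 \<le> i \<Longrightarrow> \<epsilon> i \<in> borel_measurable \<P>"
    and Y_eq: "\<And>i \<omega>. 1 \<le> i \<Longrightarrow> \<omega> \<in> space \<P> \<Longrightarrow> Y i \<omega> = f (X i \<omega>) + \<epsilon> i \<omega>"
    and distr_X: "\<And>i. 1 \<le> i \<Longrightarrow> distr \<P> (borel_on \<X>) (X i) = PX"
    and indep_XY: "indep_vars (\<lambda>_. borel_on \<X> \<Otimes>\<^sub>M borel) (\<lambda>i \<omega>. (X i \<omega>, Y i \<omega>)) {1..}"
    and cond_mean_\<epsilon>: "\<And>i. 1 \<le> i \<Longrightarrow>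
      AE \<omega> in \<P>. real_cond_exp \<P> (vimage_algebra (space \<P>) (X i) (borel_on \<X>)) (\<epsilon> i) \<omega> = 0"
    and cond_var_\<epsilon>: "\<And>i. 1 \<le> i \<Longrightarrow>
      AE \<omega> in \<P>. nn_cond_exp \<P> (vimage_algebra (space \<P>) (X i) (borel_on \<X>))
        (\<lambda>\<omega>. ennreal ((\<epsilon> i \<omega>)\<^sup>2)) \<omega> < \<infinity>"

(* \<delta> n z x is the value at x of the estimate computed from the sample (z 1, ..., z n).
   Joint measurability in sample and point makes the losses and the cross validation
   criterion random variables. *)
type_synonym 'a procedure = "nat \<Rightarrow> (nat \<Rightarrow> 'a \<times> real) \<Rightarrow> 'a \<Rightarrow> real"

definition regression_procedure :: "'a::topological_space set \<Rightarrow> 'a procedure \<Rightarrow> bool" where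
  "regression_procedure \<X> \<delta> \<longleftrightarrow>
    (\<forall>n\<ge>1. (\<lambda>(z, x). \<delta> n z x) \<in>
      borel_measurable ((\<Pi>\<^sub>M i\<in>{1..n}. borel_on \<X> \<Otimes>\<^sub>M borel) \<Otimes>\<^sub>M borel_on \<X>))"

definition estimator ::
  "'a procedure \<Rightarrow> (nat \<Rightarrow> 'w \<Rightarrow> 'a) \<Rightarrow> (nat \<Rightarrow> 'w \<Rightarrow> real) \<Rightarrow> nat \<Rightarrow> 'w \<Rightarrow> 'a \<Rightarrow> real" where
  "estimator \<delta> X Y n \<omega> = \<delta> n (\<lambda>i\<in>{1..n}. (X i \<omega>, Y i \<omega>))"

(* Norms are extended-valued: estimators need not have finite norm surely.
   In a quotient of norms, ennreal division gives 0 / 0 = top / top = 0; for losses with an exact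
   L2 rate the denominator is 0 or top only with probability tending to 0. *)
definition Lq_norm :: "real \<Rightarrow> 'a measure \<Rightarrow> ('a \<Rightarrow> real) \<Rightarrow> ennreal" where
  "Lq_norm q \<mu> g =
    (let I = (\<integral>\<^sup>+x. ennreal (\<bar>g x\<bar> powr q) \<partial>\<mu>)
     in if I = \<infinity> then \<infinity> else ennreal (enn2real I powr (1 / q)))"

definition Linf_norm :: "'a measure \<Rightarrow> ('a \<Rightarrow> real) \<Rightarrow> ennreal" where
  "Linf_norm \<mu> g = esssup \<mu> (\<lambda>x. ennreal \<bar>g x\<bar>)"

definition Lq_loss :: "real \<Rightarrow> 'a measure \<Rightarrow> ('a \<Rightarrow> real) \<Rightarrow> 'a procedure \<Rightarrow>
    (nat \<Rightarrow> 'w \<Rightarrow> 'a) \<Rightarrow> (nat \<Rightarrow> 'w \<Rightarrow> real) \<Rightarrow> nat \<Rightarrow> 'w \<Rightarrow> ennreal" where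
  "Lq_loss q \<mu> f \<delta> X Y n \<omega> = Lq_norm q \<mu> (\<lambda>x. f x - estimator \<delta> X Y n \<omega> x)"

definition Linf_loss :: "'a measure \<Rightarrow> ('a \<Rightarrow> real) \<Rightarrow> 'a procedure \<Rightarrow>
    (nat \<Rightarrow> 'w \<Rightarrow> 'a) \<Rightarrow> (nat \<Rightarrow> 'w \<Rightarrow> real) \<Rightarrow> nat \<Rightarrow> 'w \<Rightarrow> ennreal" where
  "Linf_loss \<mu> f \<delta> X Y n \<omega> = Linf_norm \<mu> (\<lambda>x. f x - estimator \<delta> X Y n \<omega> x)"

definition bounded_in_prob :: "'w measure \<Rightarrow> (nat \<Rightarrow> 'w \<Rightarrow> ennreal) \<Rightarrow> (nat \<Rightarrow> real) \<Rightarrow> bool" where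
  "bounded_in_prob \<P> Z a \<longleftrightarrow>
    (\<forall>e. 0 < e \<and> e < 1 \<longrightarrow> (\<exists>C>0. \<forall>\<^sub>F n in sequentially.
      measure \<P> {\<omega> \<in> space \<P>. Z n \<omega> \<le> ennreal (C * a n)} \<ge> 1 - e))"

(* Here L1 and L2 are the random losses of the first and the second procedure. *)
definition asymptotically_better ::
  "'w measure \<Rightarrow> (nat \<Rightarrow> 'w \<Rightarrow> ennreal) \<Rightarrow> (nat \<Rightarrow> 'w \<Rightarrow> ennreal) \<Rightarrow> bool" where
  "asymptotically_better \<P> L1 L2 \<longleftrightarrow>
    (\<forall>e. 0 < e \<and> e < 1 \<longrightarrow> (\<exists>c>0. \<forall>\<^sub>F n in sequentially.
      measure \<P> {\<omega> \<in> space \<P>. L2 n \<omega> \<ge> ennreal (1 + c) * L1 n \<omega>} \<ge> 1 - e))"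

definition converges_exactly_at_rate ::
  "'w measure \<Rightarrow> (nat \<Rightarrow> 'w \<Rightarrow> ennreal) \<Rightarrow> (nat \<Rightarrow> real) \<Rightarrow> bool" where
  "converges_exactly_at_rate \<P> L a \<longleftrightarrow>
    (\<forall>n\<ge>1. 0 < a n) \<and> a \<longlonglongrightarrow> 0 \<and>
    bounded_in_prob \<P> L a \<and>
    (\<forall>e. 0 < e \<and> e < 1 \<longrightarrow> (\<exists>c>0. \<forall>\<^sub>F n in sequentially.
      measure \<P> {\<omega> \<in> space \<P>. L n \<omega> \<ge> ennreal (c * a n)} \<ge> 1 - e))"

definition cv_criterion :: "'a procedure \<Rightarrow> (nat \<Rightarrow> 'w \<Rightarrow> 'a) \<Rightarrow> (nat \<Rightarrow> 'w \<Rightarrow> real) \<Rightarrow>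
    nat \<Rightarrow> nat \<Rightarrow> 'w \<Rightarrow> real" where
  "cv_criterion \<delta> X Y n1 n \<omega> =
    (\<Sum>i\<in>{n1 + 1..n}. (Y i \<omega> - estimator \<delta> X Y n1 \<omega> (X i \<omega>))\<^sup>2)"

definition cv_selection :: "'a procedure \<Rightarrow> 'a procedure \<Rightarrow> (nat \<Rightarrow> 'w \<Rightarrow> 'a) \<Rightarrow>
    (nat \<Rightarrow> 'w \<Rightarrow> real) \<Rightarrow> nat \<Rightarrow> nat \<Rightarrow> 'w \<Rightarrow> nat" where
  "cv_selection \<delta>1 \<delta>2 X Y n1 n \<omega> =
    (if cv_criterion \<delta>1 X Y n1 n \<omega> \<le> cv_criterion \<delta>2 X Y n1 n \<omega> then 1 else 2)"

(* The first two branches exclude each other when both losses have an exact rate. *)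
definition better_procedure ::
  "'w measure \<Rightarrow> (nat \<Rightarrow> 'w \<Rightarrow> ennreal) \<Rightarrow> (nat \<Rightarrow> 'w \<Rightarrow> ennreal) \<Rightarrow> nat" where
  "better_procedure \<P> L1 L2 =
    (if asymptotically_better \<P> L1 L2 then 1
     else if asymptotically_better \<P> L2 L1 then 2
     else undefined)"

end

theory Submission
  imports Defs
begin

text \<open>
  Given the estimation sample, the difference of the two criteria is a sum of \<open>n2\<close> independent
  terms of common mean \<open>\<mu> = \<parallel>f - fb\<parallel>\<^sup>2 - \<parallel>f - fa\<parallel>\<^sup>2\<close> (\<open>L\<^sub>2\<close> norms, \<open>fa\<close> the better
  estimate and \<open>fb\<close> the worse one), whose second moments are bounded by the fourth powers of the
  \<open>L\<^sub>4\<close> losses plus \<open>\<sigma>2\<close> times the squares of the \<open>L\<^sub>2\<close> losses. Outside an event of small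
  probability \<open>\<mu>\<close> is at least a constant multiple of \<open>\<parallel>f - fb\<parallel>\<^sup>2\<close>, and \<open>\<parallel>f - fb\<parallel>\<close> is at least a
  constant multiple of \<open>max p q\<close>. Chebyshev's inequality then bounds the conditional
  probability of preferring \<open>fb\<close> by a multiple of \<open>M ^ 4 / n2 + 1 / (n2 * (max p q)\<^sup>2)\<close>.
\<close>

section \<open>Chebyshev's inequality for independent sums\<close>

text \<open>Centred independent variables with finite second moments are orthogonal, so all cross
  terms vanish. Integrability is carried through the induction together with the value, because the
  product rule for independent variables needs the partial sum to be integrable.\<close>

lemma (in prob_space) second_moment_sum_indep:
  fixes D :: "'i \<Rightarrow> 'a \<Rightarrow> real"
  assumes "finite I" "indep_vars (\<lambda>_. borel) D I"
    and "\<And>i. i \<in> I \<Longrightarrow> integrable M (\<lambda>x. (D i x)\<^sup>2)"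
    and "\<And>i. i \<in> I \<Longrightarrow> expectation (D i) = 0"
  shows "integrable M (\<lambda>x. (\<Sum>i\<in>I. D i x)\<^sup>2) \<and>
    expectation (\<lambda>x. (\<Sum>i\<in>I. D i x)\<^sup>2) = (\<Sum>i\<in>I. expectation (\<lambda>x. (D i x)\<^sup>2))"
  using assms
proof (induction I rule: finite_induct)
  case (insert i I)
  let ?S = "\<lambda>x. \<Sum>i\<in>I. D i x"
  have rv[measurable]: "random_variable borel (D j)" if "j \<in> insert i I" for j
    using insert.prems(1) that by (auto simp: indep_vars_def2)
  have [measurable]: "random_variable borel (D i)" "random_variable borel ?S"
    using rv by (auto intro!: borel_measurable_sum)
  have IH: "integrable M (\<lambda>x. (?S x)\<^sup>2)"
    "expectation (\<lambda>x. (?S x)\<^sup>2) = (\<Sum>i\<in>I. expectation (\<lambda>x. (D i x)\<^sup>2))"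
    using insert.IH insert.prems indep_vars_subset[of "\<lambda>_. borel" D "insert i I" I] by auto
  have sq: "integrable M (\<lambda>x. (D i x)\<^sup>2)" and mean: "expectation (D i) = 0"
    using insert.prems by auto
  have int: "integrable M (D i)" "integrable M ?S"
    using sq IH(1) by (auto intro!: square_integrable_imp_integrable)
  have ind: "indep_var borel (D i) borel ?S"
    using insert by (intro indep_vars_sum) auto
  have prod: "integrable M (\<lambda>x. D i x * ?S x)" "expectation (\<lambda>x. D i x * ?S x) = 0"
    using indep_var_integrable[OF ind int] indep_var_lebesgue_integral[OF ind int] mean by auto
  have eq: "(\<Sum>j\<in>insert i I. D j x)\<^sup>2 = (D i x)\<^sup>2 + (?S x)\<^sup>2 + 2 * (D i x * ?S x)" for x
    using insert.hyps by (simp add: power2_sum)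
  have int': "integrable M (\<lambda>x. (D i x)\<^sup>2 + (?S x)\<^sup>2)" "integrable M (\<lambda>x. 2 * (D i x * ?S x))"
    using sq IH(1) prod(1) by (auto intro: Bochner_Integration.integrable_add integrable_mult_right)
  have "expectation (\<lambda>x. (\<Sum>j\<in>insert i I. D j x)\<^sup>2)
      = expectation (\<lambda>x. (D i x)\<^sup>2) + expectation (\<lambda>x. (?S x)\<^sup>2) + 2 * expectation (\<lambda>x. D i x * ?S x)"
    unfolding eq Bochner_Integration.integral_add[OF int'] Bochner_Integration.integral_add[OF sq IH(1)]
    by (subst integral_mult_right_zero) (rule refl)
  also have "\<dots> = (\<Sum>j\<in>insert i I. expectation (\<lambda>x. (D j x)\<^sup>2))"
    unfolding IH(2) prod(2) sum.insert[OF insert.hyps] by simp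
  finally show ?case
    unfolding eq by (intro conjI Bochner_Integration.integrable_add[OF int'])
qed simp

text \<open>A sum that is at most 0 lies at least \<open>card I * \<mu>\<close> below its mean, and
  Chebyshev's inequality bounds the chance of this. The variance of each term is at most its second
  moment, hence at most \<open>V\<close>.\<close>

lemma (in prob_space) prob_sum_indep_nonpos_le:
  fixes D :: "'i \<Rightarrow> 'a \<Rightarrow> real"
  assumes fin: "finite I" "I \<noteq> {}" and ind: "indep_vars (\<lambda>_. borel) D I"
    and sq: "\<And>i. i \<in> I \<Longrightarrow> integrable M (\<lambda>x. (D i x)\<^sup>2)"
    and mean: "\<And>i. i \<in> I \<Longrightarrow> expectation (D i) = \<mu>" and "0 < \<mu>"
    and V: "\<And>i. i \<in> I \<Longrightarrow> expectation (\<lambda>x. (D i x)\<^sup>2) \<le> V"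
  shows "prob {x \<in> space M. (\<Sum>i\<in>I. D i x) \<le> 0} \<le> V / (real (card I) * \<mu>\<^sup>2)"
proof -
  let ?N = "real (card I)"
  have N: "0 < ?N" using fin by (simp add: card_gt_0_iff)
  have rv[measurable]: "random_variable borel (D j)" if "j \<in> I" for j
    using ind that by (auto simp: indep_vars_def2)
  have int: "integrable M (D i)" if "i \<in> I" for i
    by (rule square_integrable_imp_integrable[OF rv[OF that] sq[OF that]])
  let ?C = "\<lambda>i x. D i x - \<mu>"
  have ind': "indep_vars (\<lambda>_. borel) ?C I"
    using ind by (rule indep_vars_compose2) auto
  have sqC: "integrable M (\<lambda>x. (?C i x)\<^sup>2)" if "i \<in> I" for i
    using sq[OF that] int[OF that] by (simp add: power2_diff)
  have meanC: "expectation (?C i) = 0" if "i \<in> I" for i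
    using int[OF that] mean[OF that] by (simp add: prob_space)
  have varC: "expectation (\<lambda>x. (?C i x)\<^sup>2) \<le> V" if "i \<in> I" for i
  proof -
    have "expectation (\<lambda>x. (?C i x)\<^sup>2) = expectation (\<lambda>x. (D i x)\<^sup>2) - \<mu>\<^sup>2"
      using variance_eq[OF int[OF that] sq[OF that]] unfolding mean[OF that] .
    also have "\<dots> \<le> V" using V[OF that] zero_le_power2[of \<mu>] by linarith
    finally show ?thesis .
  qed
  let ?S = "\<lambda>x. \<Sum>i\<in>I. ?C i x"
  have m: "integrable M (\<lambda>x. (?S x)\<^sup>2)"
    "expectation (\<lambda>x. (?S x)\<^sup>2) = (\<Sum>i\<in>I. expectation (\<lambda>x. (?C i x)\<^sup>2))"
    using second_moment_sum_indep[OF fin(1) ind' sqC meanC] by auto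
  have [measurable]: "random_variable borel ?S"
    by (intro borel_measurable_sum) (use rv in auto)
  have "expectation ?S = 0"
    using int mean by (subst Bochner_Integration.integral_sum) (auto simp: prob_space)
  with Chebyshev_inequality[of ?S "?N * \<mu>"] m N \<open>0 < \<mu>\<close>
  have "prob {x \<in> space M. ?N * \<mu> \<le> \<bar>?S x\<bar>} \<le> expectation (\<lambda>x. (?S x)\<^sup>2) / (?N * \<mu>)\<^sup>2"
    by simp
  also have "\<dots> \<le> (?N * V) / (?N * \<mu>)\<^sup>2"
    unfolding m(2) using sum_mono[OF varC] by (intro divide_right_mono) auto
  also have "\<dots> = V / (?N * \<mu>\<^sup>2)"
    using N by (simp add: power2_eq_square)
  finally have *: "prob {x \<in> space M. ?N * \<mu> \<le> \<bar>?S x\<bar>} \<le> V / (?N * \<mu>\<^sup>2)" .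
  have "prob {x \<in> space M. (\<Sum>i\<in>I. D i x) \<le> 0} \<le> prob {x \<in> space M. ?N * \<mu> \<le> \<bar>?S x\<bar>}"
    by (intro finite_measure_mono) (auto simp: sum_subtractf)
  with * show ?thesis by simp
qed

section \<open>Independent pairs, intersections of likely events, norms as moments\<close>

text \<open>Fubini's theorem in place of conditioning: the joint law is the product of the
  marginals, so the probability is the average over \<open>z\<close> of the probabilities of the
  sections of \<open>A\<close>. This lets the estimates be treated as fixed functions while the
  validation data stay random.\<close>

lemma (in prob_space) prob_indep_pair_le:
  assumes ind: "indep_var S Z T W" and A: "A \<in> sets (S \<Otimes>\<^sub>M T)" and "0 \<le> \<eta>"
    and le: "\<And>z. z \<in> space S \<Longrightarrow> prob {\<omega> \<in> space M. (z, W \<omega>) \<in> A} \<le> \<eta>"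
  shows "prob {\<omega> \<in> space M. (Z \<omega>, W \<omega>) \<in> A} \<le> \<eta>"
proof -
  have [measurable]: "random_variable S Z" "random_variable T W"
    using ind by (auto dest: indep_var_rv1 indep_var_rv2)
  note A[measurable]
  interpret Z: prob_space "distr M S Z" by (rule prob_space_distr) simp
  interpret W: prob_space "distr M T W" by (rule prob_space_distr) simp
  have joint: "distr M S Z \<Otimes>\<^sub>M distr M T W = distr M (S \<Otimes>\<^sub>M T) (\<lambda>\<omega>. (Z \<omega>, W \<omega>))"
    using ind by (simp add: indep_var_distribution_eq)
  have "emeasure M {\<omega> \<in> space M. (Z \<omega>, W \<omega>) \<in> A}
      = emeasure (distr M S Z \<Otimes>\<^sub>M distr M T W) A"
    unfolding joint by (subst emeasure_distr) (auto intro!: arg_cong[where f="emeasure M"])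
  also have "\<dots> = (\<integral>\<^sup>+z. emeasure (distr M T W) (Pair z -` A) \<partial>distr M S Z)"
    by (rule W.emeasure_pair_measure_alt) simp
  also have "\<dots> \<le> (\<integral>\<^sup>+z. ennreal \<eta> \<partial>distr M S Z)"
  proof (rule nn_integral_mono)
    fix z assume "z \<in> space (distr M S Z)"
    then have z: "z \<in> space S" by simp
    have "emeasure (distr M T W) (Pair z -` A) = emeasure M {\<omega> \<in> space M. (z, W \<omega>) \<in> A}"
      by (subst emeasure_distr) (auto intro!: arg_cong[where f="emeasure M"] sets_Pair1)
    then show "emeasure (distr M T W) (Pair z -` A) \<le> ennreal \<eta>"
      using le[OF z] by (simp add: emeasure_eq_measure ennreal_leI)
  qed
  also have "\<dots> = ennreal \<eta>"
    using Z.emeasure_space_1 by simp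
  finally show ?thesis
    using \<open>0 \<le> \<eta>\<close> by (simp add: emeasure_eq_measure)
qed

lemma (in prob_space) prob_conj_ge:
  assumes "{\<omega> \<in> space M. P \<omega>} \<in> events" "prob {\<omega> \<in> space M. P \<omega>} \<ge> 1 - a"
    and "{\<omega> \<in> space M. Q \<omega>} \<in> events" "prob {\<omega> \<in> space M. Q \<omega>} \<ge> 1 - b"
  shows "prob {\<omega> \<in> space M. P \<omega> \<and> Q \<omega>} \<ge> 1 - (a + b)"
proof -
  let ?P = "{\<omega> \<in> space M. P \<omega>}" and ?Q = "{\<omega> \<in> space M. Q \<omega>}"
  have eq: "{\<omega> \<in> space M. P \<omega> \<and> Q \<omega>} = ?P \<inter> ?Q" by auto
  have "prob (?P \<union> ?Q) = prob ?P + prob ?Q - prob (?P \<inter> ?Q)"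
    using assms measure_Un3[of ?P M ?Q] by (simp add: fmeasurable_eq_sets)
  moreover have "prob (?P \<union> ?Q) \<le> 1" by simp
  ultimately show ?thesis unfolding eq using assms(2,4) by linarith
qed

text \<open>A finite norm rules out the infinite branch of \<open>Lq_norm\<close>, so the root can
  be inverted to recover the integral, and an even exponent absorbs the absolute value. It
  translates the extended-valued losses for exponents 2 and 4 into ordinary moments.\<close>

lemma Lq_norm_numeral:
  fixes g :: "'a \<Rightarrow> real"
  assumes L: "Lq_norm (numeral k) \<mu> g = ennreal r" and r: "0 \<le> r" and ev: "even (numeral k :: nat)"
    and [measurable]: "g \<in> borel_measurable \<mu>"
  shows "integrable \<mu> (\<lambda>x. g x ^ numeral k)" "(\<integral>x. g x ^ numeral k \<partial>\<mu>) = r ^ numeral k"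
proof -
  define I where "I = (\<integral>\<^sup>+x. ennreal (\<bar>g x\<bar> powr numeral k) \<partial>\<mu>)"
  have L': "(if I = \<infinity> then \<infinity> else ennreal (enn2real I powr (1 / numeral k))) = ennreal r"
    using L unfolding Lq_norm_def Let_def I_def .
  then have fin: "I \<noteq> \<infinity>" by (auto split: if_splits)
  with L' r have "enn2real I powr (1 / numeral k) = r" by simp
  then have "enn2real I = r powr numeral k"
    by (auto simp: powr_powr simp del: powr_numeral)
  also have "\<dots> = r ^ numeral k" using r by simp
  finally have I: "I = ennreal (r ^ numeral k)"
    using fin by (metis ennreal_enn2real infinity_ennreal_def top.not_eq_extremum)
  have eq: "\<bar>g x\<bar> powr numeral k = g x ^ numeral k" for x
    using ev by (simp add: power_even_abs)
  have nn: "0 \<le> g x ^ numeral k" for x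
    using ev by (simp add: zero_le_even_power)
  have I': "(\<integral>\<^sup>+x. ennreal (g x ^ numeral k) \<partial>\<mu>) = ennreal (r ^ numeral k)"
    using I unfolding I_def eq .
  show "integrable \<mu> (\<lambda>x. g x ^ numeral k)"
    by (rule integrableI_nonneg) (use nn I' in auto)
  show "(\<integral>x. g x ^ numeral k \<partial>\<mu>) = r ^ numeral k"
    using r by (intro integral_eq_nn_integral[THEN trans]) (use nn I' in auto)
qed

section \<open>Moments of functions of the design points and the errors\<close>

context regression_model
begin

lemma prob_space_PX: "prob_space PX"
  using distr_X[of 1] prob_space_distr[OF measurable_X[of 1]] by simp

lemma sets_PX [measurable_cong, simp]: "sets PX = sets (borel_on \<X>)"
  using distr_X[of 1] sets_distr by (metis le_refl)

lemma measurable_Y: "1 \<le> i \<Longrightarrow> Y i \<in> borel_measurable \<P>"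
proof -
  assume i: "1 \<le> i"
  note [measurable] = measurable_X[OF i] measurable_\<epsilon>[OF i] measurable_f
  have "(\<lambda>\<omega>. f (X i \<omega>) + \<epsilon> i \<omega>) \<in> borel_measurable \<P>" by measurable
  then show "Y i \<in> borel_measurable \<P>"
    by (rule measurable_cong[THEN iffD2, rotated]) (use Y_eq[OF i] in auto)
qed

text \<open>The restriction of a finite measure to a subalgebra is again finite. This gives access
  to the rules for conditional expectations given \<open>X i\<close>.\<close>

lemma sigma_finite_subalgebra_X:
  assumes "1 \<le> i"
  shows "sigma_finite_subalgebra \<P> (vimage_algebra (space \<P>) (X i) (borel_on \<X>))"
proof -
  have "subalgebra \<P> (vimage_algebra (space \<P>) (X i) (borel_on \<X>))"
    using measurable_X[OF assms] measurable_space[OF measurable_X[OF assms]]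
    by (auto simp: subalgebra_def sets_vimage_algebra2 intro: measurable_sets)
  then interpret finite_measure_subalgebra \<P> "vimage_algebra (space \<P>) (X i) (borel_on \<X>)"
    by unfold_locales
  show ?thesis by (rule sigma_finite_subalgebra_axioms)
qed

text \<open>This is what allows functions of \<open>X i\<close> to be taken out of conditional
  expectations given \<open>X i\<close>.\<close>

lemma measurable_comp_X:
  assumes "1 \<le> i" "h \<in> measurable (borel_on \<X>) N"
  shows "(\<lambda>\<omega>. h (X i \<omega>)) \<in> measurable (vimage_algebra (space \<P>) (X i) (borel_on \<X>)) N"
proof (rule measurable_compose[OF measurable_vimage_algebra1 assms(2)])
  show "X i \<in> space \<P> \<rightarrow> space (borel_on \<X>)"
    using measurable_space[OF measurable_X[OF assms(1)]] by blast
qed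

text \<open>The factor \<open>h (X i)\<close> can be taken out of the conditional expectation, after
  which the conditional second moment is replaced by its bound \<open>s\<close>. Working with
  nonnegative extended integrals allows the result to be used for proving integrability.\<close>

lemma nn_integral_error_square_le:
  assumes i: "1 \<le> i"
    and var: "AE \<omega> in \<P>. nn_cond_exp \<P> (vimage_algebra (space \<P>) (X i) (borel_on \<X>))
      (\<lambda>\<omega>. ennreal ((\<epsilon> i \<omega>)\<^sup>2)) \<omega> \<le> ennreal s"
    and h: "h \<in> borel_measurable (borel_on \<X>)"
  shows "(\<integral>\<^sup>+\<omega>. h (X i \<omega>) * ennreal ((\<epsilon> i \<omega>)\<^sup>2) \<partial>\<P>) \<le> ennreal s * (\<integral>\<^sup>+x. h x \<partial>PX)"
proof -
  let ?F = "vimage_algebra (space \<P>) (X i) (borel_on \<X>)"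
  interpret F: sigma_finite_subalgebra \<P> ?F by (rule sigma_finite_subalgebra_X[OF i])
  note [measurable] = measurable_X[OF i] measurable_\<epsilon>[OF i] h
  have "(\<integral>\<^sup>+\<omega>. h (X i \<omega>) * ennreal ((\<epsilon> i \<omega>)\<^sup>2) \<partial>\<P>)
      = (\<integral>\<^sup>+\<omega>. h (X i \<omega>) * nn_cond_exp \<P> ?F (\<lambda>\<omega>. ennreal ((\<epsilon> i \<omega>)\<^sup>2)) \<omega> \<partial>\<P>)"
    by (rule F.nn_cond_exp_intg[symmetric, OF measurable_comp_X[OF i h]]) measurable
  also have "\<dots> \<le> (\<integral>\<^sup>+\<omega>. ennreal s * h (X i \<omega>) \<partial>\<P>)"
  proof (rule nn_integral_mono_AE)
    show "AE \<omega> in \<P>. h (X i \<omega>) * nn_cond_exp \<P> ?F (\<lambda>\<omega>. ennreal ((\<epsilon> i \<omega>)\<^sup>2)) \<omega>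
        \<le> ennreal s * h (X i \<omega>)"
      using var by eventually_elim (metis mult.commute mult_left_mono zero_le)
  qed
  also have "\<dots> = ennreal s * (\<integral>\<^sup>+\<omega>. h (X i \<omega>) \<partial>\<P>)"
    by (rule nn_integral_cmult) measurable
  also have "(\<integral>\<^sup>+\<omega>. h (X i \<omega>) \<partial>\<P>) = (\<integral>\<^sup>+x. h x \<partial>PX)"
    unfolding distr_X[OF i, symmetric] by (rule nn_integral_distr[symmetric]) measurable
  finally show ?thesis .
qed

lemma integral_comp_X:
  fixes h :: "real ^ 'd \<Rightarrow> real"
  assumes i: "1 \<le> i" and h: "integrable PX h"
  shows "integrable \<P> (\<lambda>\<omega>. h (X i \<omega>))" "(\<integral>\<omega>. h (X i \<omega>) \<partial>\<P>) = (\<integral>x. h x \<partial>PX)"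
proof -
  have [measurable]: "h \<in> borel_measurable (borel_on \<X>)"
    using borel_measurable_integrable[OF h] by (simp cong: measurable_cong_sets)
  show "integrable \<P> (\<lambda>\<omega>. h (X i \<omega>))"
    using h unfolding distr_X[OF i, symmetric]
    by (subst (asm) integrable_distr_eq) (use measurable_X[OF i] in auto)
  show "(\<integral>\<omega>. h (X i \<omega>) \<partial>\<P>) = (\<integral>x. h x \<partial>PX)"
    unfolding distr_X[OF i, symmetric]
    by (subst integral_distr) (use measurable_X[OF i] in auto)
qed

text \<open>Apply the bound for nonnegative integrands to the square of \<open>h\<close>: its
  right-hand side is finite, which gives integrability first and then the real-valued
  inequality.\<close>

lemma integral_square_mult_error:
  fixes h :: "real ^ 'd \<Rightarrow> real"
  assumes i: "1 \<le> i" and "0 \<le> s"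
    and var: "AE \<omega> in \<P>. nn_cond_exp \<P> (vimage_algebra (space \<P>) (X i) (borel_on \<X>))
      (\<lambda>\<omega>. ennreal ((\<epsilon> i \<omega>)\<^sup>2)) \<omega> \<le> ennreal s"
    and h: "h \<in> borel_measurable (borel_on \<X>)" and sq: "integrable PX (\<lambda>x. (h x)\<^sup>2)"
  shows "integrable \<P> (\<lambda>\<omega>. (h (X i \<omega>) * \<epsilon> i \<omega>)\<^sup>2)"
    "(\<integral>\<omega>. (h (X i \<omega>) * \<epsilon> i \<omega>)\<^sup>2 \<partial>\<P>) \<le> s * (\<integral>x. (h x)\<^sup>2 \<partial>PX)"
proof -
  note [measurable] = measurable_X[OF i] measurable_\<epsilon>[OF i] h
  have "(\<integral>\<^sup>+\<omega>. ennreal ((h (X i \<omega>) * \<epsilon> i \<omega>)\<^sup>2) \<partial>\<P>)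
      = (\<integral>\<^sup>+\<omega>. ennreal ((h (X i \<omega>))\<^sup>2) * ennreal ((\<epsilon> i \<omega>)\<^sup>2) \<partial>\<P>)"
    by (simp add: power_mult_distrib ennreal_mult)
  also have "\<dots> \<le> ennreal s * (\<integral>\<^sup>+x. ennreal ((h x)\<^sup>2) \<partial>PX)"
    by (rule nn_integral_error_square_le[OF i var]) measurable
  also have "\<dots> = ennreal (s * (\<integral>x. (h x)\<^sup>2 \<partial>PX))"
    using \<open>0 \<le> s\<close> by (subst nn_integral_eq_integral[OF sq]) (auto simp: ennreal_mult)
  finally have le: "(\<integral>\<^sup>+\<omega>. ennreal ((h (X i \<omega>) * \<epsilon> i \<omega>)\<^sup>2) \<partial>\<P>) \<le> ennreal (s * (\<integral>x. (h x)\<^sup>2 \<partial>PX))" .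
  show int: "integrable \<P> (\<lambda>\<omega>. (h (X i \<omega>) * \<epsilon> i \<omega>)\<^sup>2)"
    by (rule integrableI_bounded) (use le in \<open>auto simp: order_le_less_trans\<close>)
  have "0 \<le> s * (\<integral>x. (h x)\<^sup>2 \<partial>PX)"
    using \<open>0 \<le> s\<close> by simp
  with le show "(\<integral>\<omega>. (h (X i \<omega>) * \<epsilon> i \<omega>)\<^sup>2 \<partial>\<P>) \<le> s * (\<integral>x. (h x)\<^sup>2 \<partial>PX)"
    by (simp add: nn_integral_eq_integral[OF int] del: zero_le_mult_iff)
qed

text \<open>Taking \<open>h (X i)\<close> out leaves the conditional mean of
  \<open>\<epsilon> i\<close> given \<open>X i\<close>, which is 0 almost surely.\<close>

lemma expectation_mult_error:
  fixes h :: "real ^ 'd \<Rightarrow> real"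
  assumes i: "1 \<le> i" and h: "h \<in> borel_measurable (borel_on \<X>)"
    and int: "integrable \<P> (\<lambda>\<omega>. h (X i \<omega>) * \<epsilon> i \<omega>)"
  shows "expectation (\<lambda>\<omega>. h (X i \<omega>) * \<epsilon> i \<omega>) = 0"
proof -
  let ?F = "vimage_algebra (space \<P>) (X i) (borel_on \<X>)"
  interpret F: sigma_finite_subalgebra \<P> ?F by (rule sigma_finite_subalgebra_X[OF i])
  have "expectation (\<lambda>\<omega>. h (X i \<omega>) * \<epsilon> i \<omega>)
      = expectation (\<lambda>\<omega>. h (X i \<omega>) * real_cond_exp \<P> ?F (\<epsilon> i) \<omega>)"
    by (rule F.real_cond_exp_intg(2)[symmetric, OF int measurable_comp_X[OF i h] measurable_\<epsilon>[OF i]])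
  also have "\<dots> = 0"
    by (rule integral_eq_zero_AE) (use cond_mean_\<epsilon>[OF i] in eventually_elim, simp)
  finally show ?thesis .
qed

section \<open>The wrong order of the criteria for two fixed estimates\<close>

text \<open>The difference of the criteria is a sum of independent terms with common positive mean,
  so the bound for nonpositive sums applies. The fourth moments in the numerator come from the
  difference of squared losses, the factor \<open>s\<close> from the noise.\<close>

lemma prob_fixed_estimates_le:
  fixes u v :: "real ^ 'd \<Rightarrow> real"
  assumes I: "finite I" "I \<noteq> {}" "I \<subseteq> {1..}" and s: "0 \<le> s"
    and var: "\<And>i. i \<in> I \<Longrightarrow> AE \<omega> in \<P>. nn_cond_exp \<P> (vimage_algebra (space \<P>) (X i) (borel_on \<X>))
      (\<lambda>\<omega>. ennreal ((\<epsilon> i \<omega>)\<^sup>2)) \<omega> \<le> ennreal s"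
    and u: "u \<in> borel_measurable (borel_on \<X>)" and v: "v \<in> borel_measurable (borel_on \<X>)"
    and u2: "integrable PX (\<lambda>x. (f x - u x)\<^sup>2)" and u4: "integrable PX (\<lambda>x. (f x - u x) ^ 4)"
    and v2: "integrable PX (\<lambda>x. (f x - v x)\<^sup>2)" and v4: "integrable PX (\<lambda>x. (f x - v x) ^ 4)"
    and less: "(\<integral>x. (f x - u x)\<^sup>2 \<partial>PX) < (\<integral>x. (f x - v x)\<^sup>2 \<partial>PX)"
  shows "prob {\<omega> \<in> space \<P>. (\<Sum>i\<in>I. (Y i \<omega> - v (X i \<omega>))\<^sup>2) \<le> (\<Sum>i\<in>I. (Y i \<omega> - u (X i \<omega>))\<^sup>2)}
    \<le> (2 * ((\<integral>x. (f x - u x) ^ 4 \<partial>PX) + (\<integral>x. (f x - v x) ^ 4 \<partial>PX))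
        + 16 * s * ((\<integral>x. (f x - u x)\<^sup>2 \<partial>PX) + (\<integral>x. (f x - v x)\<^sup>2 \<partial>PX)))
      / (real (card I) * ((\<integral>x. (f x - v x)\<^sup>2 \<partial>PX) - (\<integral>x. (f x - u x)\<^sup>2 \<partial>PX))\<^sup>2)"
    (is "_ \<le> ?V / (_ * ?\<mu>\<^sup>2)")
proof -
  \<comment> \<open>Substituting \<open>Y i = f (X i) + \<epsilon> i\<close> gives
    \<open>D i = a (X i) + h (X i) * \<epsilon> i\<close>. The function \<open>h\<close> equals
    \<open>2 * (u x - v x)\<close>, written through the two losses so that its square can be bounded
    by theirs.\<close>
  define a where "a x = (f x - v x)\<^sup>2 - (f x - u x)\<^sup>2" for x
  define h where "h x = 2 * ((f x - v x) - (f x - u x))" for x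
  define D where "D i \<omega> = (Y i \<omega> - v (X i \<omega>))\<^sup>2 - (Y i \<omega> - u (X i \<omega>))\<^sup>2" for i \<omega>
  note [measurable] = measurable_f u v
  have meas: "a \<in> borel_measurable (borel_on \<X>)" "h \<in> borel_measurable (borel_on \<X>)"
    unfolding a_def h_def by measurable
  note [measurable] = meas
  have a2_le: "(a x)\<^sup>2 \<le> (f x - u x) ^ 4 + (f x - v x) ^ 4" for x
  proof -
    have "((f x - v x)\<^sup>2 - (f x - u x)\<^sup>2)\<^sup>2
        = (f x - u x) ^ 4 + (f x - v x) ^ 4 - 2 * ((f x - v x)\<^sup>2 * (f x - u x)\<^sup>2)"
      by algebra
    moreover have "0 \<le> (f x - v x)\<^sup>2 * (f x - u x)\<^sup>2" by simp
    ultimately show ?thesis unfolding a_def by simp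
  qed
  have h2_le: "(h x)\<^sup>2 \<le> 8 * ((f x - u x)\<^sup>2 + (f x - v x)\<^sup>2)" for x
  proof -
    \<comment> \<open>Parallelogram law; the second square on the left is then dropped.\<close>
    have "(h x)\<^sup>2 + 4 * ((f x - u x) + (f x - v x))\<^sup>2 = 8 * ((f x - u x)\<^sup>2 + (f x - v x)\<^sup>2)"
      unfolding h_def by algebra
    then show ?thesis
      using zero_le_power2[of "(f x - u x) + (f x - v x)"] by linarith
  qed
  have int_a: "integrable PX a"
    unfolding a_def using u2 v2 by simp
  have int_a2: "integrable PX (\<lambda>x. (a x)\<^sup>2)"
  proof (rule Bochner_Integration.integrable_bound)
    show "integrable PX (\<lambda>x. (f x - u x) ^ 4 + (f x - v x) ^ 4)" using u4 v4 by simp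
    show "AE x in PX. norm ((a x)\<^sup>2) \<le> norm ((f x - u x) ^ 4 + (f x - v x) ^ 4)"
      using a2_le by (auto intro!: AE_I2 simp: order_trans[OF _ abs_ge_self])
  qed measurable
  have int_h2: "integrable PX (\<lambda>x. (h x)\<^sup>2)"
  proof (rule Bochner_Integration.integrable_bound)
    show "integrable PX (\<lambda>x. 8 * ((f x - u x)\<^sup>2 + (f x - v x)\<^sup>2))" using u2 v2 by simp
    show "AE x in PX. norm ((h x)\<^sup>2) \<le> norm (8 * ((f x - u x)\<^sup>2 + (f x - v x)\<^sup>2))"
      using h2_le by (auto intro!: AE_I2 simp: order_trans[OF _ abs_ge_self])
  qed measurable
  have le_a: "(\<integral>x. (a x)\<^sup>2 \<partial>PX) \<le> (\<integral>x. (f x - u x) ^ 4 \<partial>PX) + (\<integral>x. (f x - v x) ^ 4 \<partial>PX)"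
    using integral_mono[OF int_a2 Bochner_Integration.integrable_add[OF u4 v4] a2_le] u4 v4 by simp
  have le_h: "(\<integral>x. (h x)\<^sup>2 \<partial>PX) \<le> 8 * ((\<integral>x. (f x - u x)\<^sup>2 \<partial>PX) + (\<integral>x. (f x - v x)\<^sup>2 \<partial>PX))"
    using integral_mono[OF int_h2 integrable_mult_right[OF Bochner_Integration.integrable_add[OF u2 v2]] h2_le]
      u2 v2 by simp
  have mean_a: "(\<integral>x. a x \<partial>PX) = ?\<mu>"
    unfolding a_def using u2 v2 by simp
  have D: "integrable \<P> (\<lambda>\<omega>. (D i \<omega>)\<^sup>2) \<and> expectation (D i) = ?\<mu> \<and> expectation (\<lambda>\<omega>. (D i \<omega>)\<^sup>2) \<le> ?V"
    if "i \<in> I" for i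
  proof -
    have i: "1 \<le> i" using that I by auto
    note [measurable] = measurable_X[OF i] measurable_\<epsilon>[OF i] measurable_Y[OF i]
    define aX where "aX \<omega> = a (X i \<omega>)" for \<omega>
    define hE where "hE \<omega> = h (X i \<omega>) * \<epsilon> i \<omega>" for \<omega>
    have [measurable]: "aX \<in> borel_measurable \<P>" "hE \<in> borel_measurable \<P>" "D i \<in> borel_measurable \<P>"
      unfolding aX_def hE_def D_def by measurable
    have D_eq: "D i \<omega> = aX \<omega> + hE \<omega>" if "\<omega> \<in> space \<P>" for \<omega>
      unfolding D_def aX_def hE_def a_def h_def Y_eq[OF i that] by algebra
    have hE2: "integrable \<P> (\<lambda>\<omega>. (hE \<omega>)\<^sup>2)"
      "expectation (\<lambda>\<omega>. (hE \<omega>)\<^sup>2) \<le> s * (\<integral>x. (h x)\<^sup>2 \<partial>PX)"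
      unfolding hE_def using integral_square_mult_error[OF i s var[OF that] meas(2) int_h2] by auto
    \<comment> \<open>On a probability space square integrability implies integrability, which the
      zero-mean lemma requires.\<close>
    have hE1: "integrable \<P> hE"
      by (rule square_integrable_imp_integrable) (use hE2 in auto)
    have hE0: "expectation hE = 0"
      using expectation_mult_error[OF i meas(2)] hE1 unfolding hE_def .
    have aX1: "integrable \<P> aX" "expectation aX = ?\<mu>"
      unfolding aX_def using integral_comp_X[OF i int_a] mean_a by auto
    have aX2: "integrable \<P> (\<lambda>\<omega>. (aX \<omega>)\<^sup>2)" "expectation (\<lambda>\<omega>. (aX \<omega>)\<^sup>2) = (\<integral>x. (a x)\<^sup>2 \<partial>PX)"
      unfolding aX_def using integral_comp_X[OF i int_a2] by auto
    have D2_le: "(D i \<omega>)\<^sup>2 \<le> 2 * (aX \<omega>)\<^sup>2 + 2 * (hE \<omega>)\<^sup>2" if "\<omega> \<in> space \<P>" for \<omega>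
    proof -
      \<comment> \<open>Again the parallelogram law. The factor 2 here produces the 2 in the bound
        and, with the 8 from \<open>h2_le\<close>, the 16.\<close>
      have "(aX \<omega> + hE \<omega>)\<^sup>2 + (aX \<omega> - hE \<omega>)\<^sup>2 = 2 * (aX \<omega>)\<^sup>2 + 2 * (hE \<omega>)\<^sup>2" by algebra
      then show ?thesis
        unfolding D_eq[OF that] using zero_le_power2[of "aX \<omega> - hE \<omega>"] by linarith
    qed
    have int_b: "integrable \<P> (\<lambda>\<omega>. 2 * (aX \<omega>)\<^sup>2 + 2 * (hE \<omega>)\<^sup>2)"
      using aX2(1) hE2(1) by simp
    have D2: "integrable \<P> (\<lambda>\<omega>. (D i \<omega>)\<^sup>2)"
    proof (rule Bochner_Integration.integrable_bound[OF int_b])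
      show "AE \<omega> in \<P>. norm ((D i \<omega>)\<^sup>2) \<le> norm (2 * (aX \<omega>)\<^sup>2 + 2 * (hE \<omega>)\<^sup>2)"
        using D2_le by (intro AE_I2) auto
    qed measurable
    have "expectation (D i) = expectation (\<lambda>\<omega>. aX \<omega> + hE \<omega>)"
      by (rule Bochner_Integration.integral_cong) (auto simp: D_eq)
    also have "\<dots> = ?\<mu>"
      unfolding Bochner_Integration.integral_add[OF aX1(1) hE1] aX1(2) hE0 by simp
    finally have D1: "expectation (D i) = ?\<mu>" .
    have "expectation (\<lambda>\<omega>. (D i \<omega>)\<^sup>2) \<le> expectation (\<lambda>\<omega>. 2 * (aX \<omega>)\<^sup>2 + 2 * (hE \<omega>)\<^sup>2)"
      by (rule integral_mono[OF D2 int_b D2_le])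
    also have "\<dots> = 2 * (\<integral>x. (a x)\<^sup>2 \<partial>PX) + 2 * expectation (\<lambda>\<omega>. (hE \<omega>)\<^sup>2)"
      using aX2 hE2(1) by simp
    also have "\<dots> \<le> ?V"
      using le_a hE2(2) mult_left_mono[OF le_h s] by (simp add: algebra_simps)
    finally show ?thesis using D1 D2 by blast
  qed
  have ind: "indep_vars (\<lambda>_. borel) D I"
  proof -
    \<comment> \<open>Since \<open>u\<close> and \<open>v\<close> are fixed, every
      \<open>D i\<close> is the same measurable function of the pair \<open>(X i, Y i)\<close> and
      inherits the independence of the pairs.\<close>
    have "indep_vars (\<lambda>_. borel) (\<lambda>i \<omega>. (\<lambda>(x, y). (y - v x)\<^sup>2 - (y - u x)\<^sup>2) (X i \<omega>, Y i \<omega>)) I"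
      by (rule indep_vars_compose2[OF indep_vars_subset[OF indep_XY I(3)]]) measurable
    then show ?thesis unfolding D_def by simp
  qed
  have "prob {\<omega> \<in> space \<P>. (\<Sum>i\<in>I. D i \<omega>) \<le> 0} \<le> ?V / (real (card I) * ?\<mu>\<^sup>2)"
    by (rule prob_sum_indep_nonpos_le[OF I(1,2) ind]) (use D less in auto)
  then show ?thesis
    unfolding D_def sum_subtractf by simp
qed

section \<open>Measurability, and freezing the estimation sample\<close>

lemma measurable_Lq_norm_procedure:
  assumes \<delta>: "regression_procedure \<X> \<delta>" and m: "1 \<le> m"
  shows "(\<lambda>z. Lq_norm q PX (\<lambda>x. f x - \<delta> m z x))
    \<in> borel_measurable (\<Pi>\<^sub>M i\<in>{1..m}. borel_on \<X> \<Otimes>\<^sub>M borel)"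
proof -
  \<comment> \<open>Integrating a jointly measurable function over \<open>x\<close> leaves a
    measurable function of \<open>z\<close> because \<open>PX\<close> is sigma-finite.\<close>
  interpret PX: prob_space PX by (rule prob_space_PX)
  have [measurable]: "(\<lambda>(z, x). \<delta> m z x)
      \<in> borel_measurable ((\<Pi>\<^sub>M i\<in>{1..m}. borel_on \<X> \<Otimes>\<^sub>M borel) \<Otimes>\<^sub>M borel_on \<X>)"
    using \<delta> m unfolding regression_procedure_def by blast
  note [measurable] = measurable_f
  show ?thesis
    unfolding Lq_norm_def Let_def by measurable
qed

lemma measurable_cv_criterion:
  assumes \<delta>: "regression_procedure \<X> \<delta>" and m: "1 \<le> m"
  shows "cv_criterion \<delta> X Y m n \<in> borel_measurable \<P>"
proof -
  have [measurable]: "X i \<in> measurable \<P> (borel_on \<X>)" "Y i \<in> borel_measurable \<P>"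
    if "i \<in> {1..}" for i
    using measurable_X measurable_Y that by auto
  have [measurable]: "(\<lambda>(z, x). \<delta> m z x)
      \<in> borel_measurable ((\<Pi>\<^sub>M i\<in>{1..m}. borel_on \<X> \<Otimes>\<^sub>M borel) \<Otimes>\<^sub>M borel_on \<X>)"
    using \<delta> m unfolding regression_procedure_def by blast
  have [measurable]: "(\<lambda>\<omega>. \<lambda>i\<in>{1..m}. (X i \<omega>, Y i \<omega>))
      \<in> measurable \<P> (\<Pi>\<^sub>M i\<in>{1..m}. borel_on \<X> \<Otimes>\<^sub>M borel)"
    by (intro measurable_restrict measurable_Pair) auto
  show ?thesis
    unfolding cv_criterion_def
  proof (rule borel_measurable_sum)
    fix i assume "i \<in> {m + 1..n}"
    then have [measurable]: "i \<in> {1..}" by auto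
    \<comment> \<open>The uncurried form matches \<open>regression_procedure\<close>; it is
      evaluated at the estimation sample and a further design point, both random.\<close>
    have "(\<lambda>\<omega>. (\<lambda>(z, x). \<delta> m z x) (\<lambda>i\<in>{1..m}. (X i \<omega>, Y i \<omega>), X i \<omega>)) \<in> borel_measurable \<P>"
      by measurable
    then have [measurable]: "(\<lambda>\<omega>. estimator \<delta> X Y m \<omega> (X i \<omega>)) \<in> borel_measurable \<P>"
      by (simp add: estimator_def)
    show "(\<lambda>\<omega>. (Y i \<omega> - estimator \<delta> X Y m \<omega> (X i \<omega>))\<^sup>2) \<in> borel_measurable \<P>"
      by measurable
  qed
qed

text \<open>The estimation and validation samples are independent, so the estimation sample may be
  frozen at \<open>z\<close>. The predicate \<open>G\<close> selects good samples: outside it the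
  event is empty, so the bound for fixed estimates is required only on \<open>G\<close>.\<close>

lemma prob_cv_criterion_le:
  assumes \<delta>: "regression_procedure \<X> \<delta>a" "regression_procedure \<X> \<delta>b" and m: "1 \<le> m"
    and G: "{z \<in> space (\<Pi>\<^sub>M i\<in>{1..m}. borel_on \<X> \<Otimes>\<^sub>M borel). G z}
      \<in> sets (\<Pi>\<^sub>M i\<in>{1..m}. borel_on \<X> \<Otimes>\<^sub>M borel)"
    and "0 \<le> \<eta>"
    and le: "\<And>z. z \<in> space (\<Pi>\<^sub>M i\<in>{1..m}. borel_on \<X> \<Otimes>\<^sub>M borel) \<Longrightarrow> G z \<Longrightarrow>
      prob {\<omega> \<in> space \<P>. (\<Sum>i\<in>{m + 1..n}. (Y i \<omega> - \<delta>b m z (X i \<omega>))\<^sup>2)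
        \<le> (\<Sum>i\<in>{m + 1..n}. (Y i \<omega> - \<delta>a m z (X i \<omega>))\<^sup>2)} \<le> \<eta>"
  shows "prob {\<omega> \<in> space \<P>. G (\<lambda>i\<in>{1..m}. (X i \<omega>, Y i \<omega>)) \<and>
      cv_criterion \<delta>b X Y m n \<omega> \<le> cv_criterion \<delta>a X Y m n \<omega>} \<le> \<eta>"
proof -
  let ?S = "\<Pi>\<^sub>M i\<in>{1..m}. borel_on \<X> \<Otimes>\<^sub>M (borel :: real measure)"
  let ?T = "\<Pi>\<^sub>M i\<in>{m + 1..n}. borel_on \<X> \<Otimes>\<^sub>M (borel :: real measure)"
  let ?Z = "\<lambda>\<omega>. \<lambda>i\<in>{1..m}. (X i \<omega>, Y i \<omega>)" and ?W = "\<lambda>\<omega>. \<lambda>i\<in>{m + 1..n}. (X i \<omega>, Y i \<omega>)"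
  \<comment> \<open>The criterion as a function of two separate samples, so that the event becomes a
    measurable set \<open>A\<close> in a product space.\<close>
  define C where "C \<delta> z w = (\<Sum>i\<in>{m + 1..n}. (snd (w i) - \<delta> m z (fst (w i)))\<^sup>2)"
    for \<delta> :: "(real ^ 'd) procedure" and z and w :: "nat \<Rightarrow> (real ^ 'd) \<times> real"
  have C_meas: "(\<lambda>p. C \<delta> (fst p) (snd p)) \<in> borel_measurable (?S \<Otimes>\<^sub>M ?T)"
    if "regression_procedure \<X> \<delta>" for \<delta>
  proof -
    have [measurable]: "(\<lambda>(z, x). \<delta> m z x) \<in> borel_measurable (?S \<Otimes>\<^sub>M borel_on \<X>)"
      using that m unfolding regression_procedure_def by blast
    show ?thesis
      unfolding C_def
    proof (rule borel_measurable_sum)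
      fix i assume i[measurable]: "i \<in> {m + 1..n}"
      have [measurable]: "(\<lambda>p. snd p i) \<in> measurable (?S \<Otimes>\<^sub>M ?T) (borel_on \<X> \<Otimes>\<^sub>M borel)"
        using i by (intro measurable_compose[OF measurable_snd measurable_component_singleton])
      have [measurable]: "(\<lambda>p. fst (snd p i)) \<in> measurable (?S \<Otimes>\<^sub>M ?T) (borel_on \<X>)"
        "(\<lambda>p. snd (snd p i)) \<in> borel_measurable (?S \<Otimes>\<^sub>M ?T)"
        by measurable
      have "(\<lambda>p. (\<lambda>(z, x). \<delta> m z x) (fst p, fst (snd p i))) \<in> borel_measurable (?S \<Otimes>\<^sub>M ?T)"
        by measurable
      then have [measurable]: "(\<lambda>p. \<delta> m (fst p) (fst (snd p i))) \<in> borel_measurable (?S \<Otimes>\<^sub>M ?T)"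
        by simp
      show "(\<lambda>p. (snd (snd p i) - \<delta> m (fst p) (fst (snd p i)))\<^sup>2) \<in> borel_measurable (?S \<Otimes>\<^sub>M ?T)"
        by measurable
    qed
  qed
  define A where "A = {p \<in> space (?S \<Otimes>\<^sub>M ?T). G (fst p) \<and> C \<delta>b (fst p) (snd p) \<le> C \<delta>a (fst p) (snd p)}"
  note [measurable] = C_meas[OF \<delta>(1)] C_meas[OF \<delta>(2)]
  have G': "Measurable.pred ?S G" using G by (simp add: pred_def)
  have [measurable]: "Measurable.pred (?S \<Otimes>\<^sub>M ?T) (\<lambda>p. G (fst p))"
    by (rule measurable_compose[OF measurable_fst G'])
  have A_sets: "A \<in> sets (?S \<Otimes>\<^sub>M ?T)"
    unfolding A_def by measurable
  have ind: "indep_var ?S ?Z ?T ?W"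
    \<comment> \<open>The index sets \<open>{1..m}\<close> and \<open>{m + 1..n}\<close> are
      disjoint.\<close>
    by (rule indep_var_restrict[OF indep_XY]) auto
  have ZS: "?Z \<omega> \<in> space ?S" and WT: "?W \<omega> \<in> space ?T" if "\<omega> \<in> space \<P>" for \<omega>
    using measurable_space[OF indep_var_rv1[OF ind] that] measurable_space[OF indep_var_rv2[OF ind] that]
    by auto
  have CW: "C \<delta> z (?W \<omega>) = (\<Sum>i\<in>{m + 1..n}. (Y i \<omega> - \<delta> m z (X i \<omega>))\<^sup>2)" for \<delta> z \<omega>
    unfolding C_def by (intro sum.cong) auto
  have "prob {\<omega> \<in> space \<P>. (?Z \<omega>, ?W \<omega>) \<in> A} \<le> \<eta>"
  proof (rule prob_indep_pair_le[OF ind A_sets \<open>0 \<le> \<eta>\<close>])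
    fix z assume z: "z \<in> space ?S"
    have eq: "{\<omega> \<in> space \<P>. (z, ?W \<omega>) \<in> A} = {\<omega> \<in> space \<P>. G z \<and>
        (\<Sum>i\<in>{m + 1..n}. (Y i \<omega> - \<delta>b m z (X i \<omega>))\<^sup>2) \<le> (\<Sum>i\<in>{m + 1..n}. (Y i \<omega> - \<delta>a m z (X i \<omega>))\<^sup>2)}"
      unfolding A_def using z WT by (auto simp: space_pair_measure CW simp del: One_nat_def)
    show "prob {\<omega> \<in> space \<P>. (z, ?W \<omega>) \<in> A} \<le> \<eta>"
      unfolding eq using le[OF z] \<open>0 \<le> \<eta>\<close> by (cases "G z") simp_all
  qed
  moreover have "{\<omega> \<in> space \<P>. (?Z \<omega>, ?W \<omega>) \<in> A} = {\<omega> \<in> space \<P>. G (?Z \<omega>) \<and>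
      cv_criterion \<delta>b X Y m n \<omega> \<le> cv_criterion \<delta>a X Y m n \<omega>}"
    unfolding A_def using ZS WT
    by (auto simp: space_pair_measure CW cv_criterion_def estimator_def simp del: One_nat_def)
  ultimately show ?thesis by simp
qed

end

section \<open>Deterministic bounds and their limit\<close>

text \<open>Here \<open>ra\<close> and \<open>rb\<close> stand for the L2 losses of the better and
  the worse estimate, \<open>Fa\<close> and \<open>Fb\<close> for the fourth moments. Numerator and
  denominator are compared with \<open>rb ^ 4\<close>, which cancels: the margin \<open>c\<close>
  keeps the gap of squares above a fixed fraction of the square of \<open>rb\<close>, and
  \<open>t \<le> rb\<close> controls the noise term.\<close>

lemma variance_bound_over_gap_le:
  fixes ra rb t c k s N :: real
  assumes r: "0 < ra" "(1 + c) * ra \<le> rb" "t \<le> rb" and t: "0 < t" and c: "0 < c"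
    and "0 \<le> k" "0 \<le> s" and N: "0 < N"
    and Fa: "Fa \<le> (k * ra) ^ 4" and Fb: "Fb \<le> (k * rb) ^ 4"
  shows "ra\<^sup>2 < rb\<^sup>2"
    "(2 * (Fa + Fb) + 16 * s * (ra\<^sup>2 + rb\<^sup>2)) / (N * (rb\<^sup>2 - ra\<^sup>2)\<^sup>2)
      \<le> (4 * k ^ 4 + 32 * s / t\<^sup>2) / (N * (1 - 1 / (1 + c)\<^sup>2)\<^sup>2)"
proof -
  define \<kappa> where "\<kappa> = 1 - 1 / (1 + c)\<^sup>2"
  have "ra < (1 + c) * ra" using c r(1) by simp
  with r have rab: "ra < rb" by linarith
  have rb: "0 < rb" using rab r by linarith
  show less: "ra\<^sup>2 < rb\<^sup>2" using rab r(1) by (intro power_strict_mono) auto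
  have "1 < (1 + c)\<^sup>2" using c by (intro one_less_power) auto
  then have \<kappa>: "0 < \<kappa>" unfolding \<kappa>_def by (simp add: divide_less_eq_1)
  have "((1 + c) * ra)\<^sup>2 \<le> rb\<^sup>2" using r c by (intro power_mono) auto
  then have "ra\<^sup>2 \<le> rb\<^sup>2 / (1 + c)\<^sup>2"
    using c by (simp add: power_mult_distrib pos_le_divide_eq mult.commute)
  then have gap: "\<kappa> * rb\<^sup>2 \<le> rb\<^sup>2 - ra\<^sup>2" unfolding \<kappa>_def by (simp add: algebra_simps)
  have "(k * ra) ^ 4 \<le> (k * rb) ^ 4"
    using rab r(1) \<open>0 \<le> k\<close> by (intro power_mono mult_left_mono mult_nonneg_nonneg) auto
  then have F: "2 * (Fa + Fb) \<le> 4 * k ^ 4 * rb ^ 4"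
    using Fa Fb by (simp add: power_mult_distrib)
  \<comment> \<open>The noise term is only quadratic in \<open>rb\<close>; the lower bound
    \<open>t\<close> on \<open>rb\<close> raises it to fourth order.\<close>
  have "t\<^sup>2 * rb\<^sup>2 \<le> rb\<^sup>2 * rb\<^sup>2"
    using r(3) t by (intro mult_right_mono power_mono) auto
  then have "rb\<^sup>2 \<le> rb ^ 4 / t\<^sup>2"
    using t by (simp add: pos_le_divide_eq mult.commute flip: power_add)
  with less have "ra\<^sup>2 + rb\<^sup>2 \<le> 2 * (rb ^ 4 / t\<^sup>2)" by linarith
  from mult_left_mono[OF this, of "16 * s"] \<open>0 \<le> s\<close>
  have "16 * s * (ra\<^sup>2 + rb\<^sup>2) \<le> 32 * s / t\<^sup>2 * rb ^ 4" by (simp add: mult.assoc)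
  with F have num: "2 * (Fa + Fb) + 16 * s * (ra\<^sup>2 + rb\<^sup>2) \<le> (4 * k ^ 4 + 32 * s / t\<^sup>2) * rb ^ 4"
    by (simp add: distrib_right)
  have den: "N * (\<kappa> * rb\<^sup>2)\<^sup>2 \<le> N * (rb\<^sup>2 - ra\<^sup>2)\<^sup>2"
    using gap \<kappa> N by (intro mult_left_mono power_mono) auto
  have pos: "0 < N * (\<kappa> * rb\<^sup>2)\<^sup>2" using N \<kappa> rb by simp
  have K: "0 \<le> (4 * k ^ 4 + 32 * s / t\<^sup>2) * rb ^ 4"
    using \<open>0 \<le> s\<close> by simp
  have "(2 * (Fa + Fb) + 16 * s * (ra\<^sup>2 + rb\<^sup>2)) / (N * (rb\<^sup>2 - ra\<^sup>2)\<^sup>2)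
      \<le> ((4 * k ^ 4 + 32 * s / t\<^sup>2) * rb ^ 4) / (N * (rb\<^sup>2 - ra\<^sup>2)\<^sup>2)"
    using num N by (intro divide_right_mono) auto
  also have "\<dots> \<le> ((4 * k ^ 4 + 32 * s / t\<^sup>2) * rb ^ 4) / (N * (\<kappa> * rb\<^sup>2)\<^sup>2)"
    by (rule divide_left_mono[OF den K]) (use pos den in \<open>auto intro!: mult_pos_pos\<close>)
  also have "(N * (\<kappa> * rb\<^sup>2)\<^sup>2) = (N * \<kappa>\<^sup>2) * rb ^ 4"
    by (simp add: power_mult_distrib flip: power_mult)
  also have "((4 * k ^ 4 + 32 * s / t\<^sup>2) * rb ^ 4) / ((N * \<kappa>\<^sup>2) * rb ^ 4)
      = (4 * k ^ 4 + 32 * s / t\<^sup>2) / (N * \<kappa>\<^sup>2)"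
    using rb by simp
  finally show "(2 * (Fa + Fb) + 16 * s * (ra\<^sup>2 + rb\<^sup>2)) / (N * (rb\<^sup>2 - ra\<^sup>2)\<^sup>2)
      \<le> (4 * k ^ 4 + 32 * s / t\<^sup>2) / (N * (1 - 1 / (1 + c)\<^sup>2)\<^sup>2)"
    unfolding \<kappa>_def .
qed

text \<open>Over a positive real denominator an infinite numerator would give an infinite quotient,
  so a finite bound forces the numerator to be real.\<close>

lemma ennreal_ratio_le_imp:
  assumes "x / ennreal r \<le> ennreal K" "0 < r" "0 \<le> K"
  obtains y where "0 \<le> y" "x = ennreal y" "y \<le> K * r"
proof -
  have "x \<noteq> \<top>"
    using assms(1) by (auto simp: ennreal_top_divide top_unique)
  then obtain y where y: "0 \<le> y" "x = ennreal y"
    by (cases x) auto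
  then have "ennreal (y / r) \<le> ennreal K" using assms by (simp add: divide_ennreal)
  then have "y / r \<le> K" using assms by simp
  then have "y \<le> K * r" using assms by (simp add: pos_divide_le_eq)
  with y that show ?thesis by blast
qed

text \<open>The expression is a combination of \<open>M n ^ 4 / N n\<close> and the inverse square
  of \<open>sqrt (N n) * t n\<close>. The first tends to 0 by \<open>NM\<close>; for the second,
  \<open>1 + A n\<close> exceeds 1, so the product dominates the diverging quotient in
  \<open>NA\<close>.\<close>

lemma variance_bound_tendsto_0:
  fixes t M N A :: "nat \<Rightarrow> real" and k s c0 \<kappa> :: real
  assumes NM: "filterlim (\<lambda>n. N n / M n ^ 4) at_top sequentially"
    and NA: "filterlim (\<lambda>n. sqrt (N n) * t n / (1 + A n)) at_top sequentially"
    and A: "\<forall>\<^sub>F n in sequentially. 0 < A n" and N: "\<And>n. 0 \<le> N n"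
  shows "(\<lambda>n. (4 * (k * M n) ^ 4 + 32 * s / (c0 * t n)\<^sup>2) / (N n * \<kappa>)) \<longlonglongrightarrow> 0"
proof -
  have 1: "(\<lambda>n. inverse (N n / M n ^ 4)) \<longlonglongrightarrow> 0"
    by (rule tendsto_inverse_0_at_top[OF NM])
  have "filterlim (\<lambda>n. sqrt (N n) * t n) at_top sequentially"
  proof (rule filterlim_at_top_mono[OF NA])
    \<comment> \<open>Comparing the quotient with its numerator requires a nonnegative numerator,
      which divergence of the quotient supplies eventually.\<close>
    have "\<forall>\<^sub>F n in sequentially. 0 \<le> sqrt (N n) * t n / (1 + A n)"
      using NA by (auto simp: filterlim_at_top)
    with A show "\<forall>\<^sub>F n in sequentially. sqrt (N n) * t n / (1 + A n) \<le> sqrt (N n) * t n"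
    proof eventually_elim
      case (elim n)
      then have "0 \<le> sqrt (N n) * t n" by (simp add: zero_le_divide_iff)
      then have "sqrt (N n) * t n * 1 \<le> sqrt (N n) * t n * (1 + A n)"
        using elim by (intro mult_left_mono) auto
      then show ?case using elim by (simp add: pos_divide_le_eq)
    qed
  qed
  then have "(\<lambda>n. inverse (sqrt (N n) * t n)) \<longlonglongrightarrow> 0"
    by (rule tendsto_inverse_0_at_top)
  then have 2: "(\<lambda>n. (inverse (sqrt (N n) * t n))\<^sup>2) \<longlonglongrightarrow> 0"
    using tendsto_power[of _ 0 _ 2] by fastforce
  have "(\<lambda>n. 4 * k ^ 4 / \<kappa> * inverse (N n / M n ^ 4)
      + 32 * s / (c0\<^sup>2 * \<kappa>) * (inverse (sqrt (N n) * t n))\<^sup>2) \<longlonglongrightarrow> 0"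
    using tendsto_add[OF tendsto_mult_left[OF 1, of "4 * k ^ 4 / \<kappa>"]
      tendsto_mult_left[OF 2, of "32 * s / (c0\<^sup>2 * \<kappa>)"]] unfolding mult_zero_right add_0_right .
  \<comment> \<open>This holds for every \<open>n\<close>, also where a factor is 0, by the
    convention \<open>inverse 0 = 0\<close>.\<close>
  moreover have "4 * k ^ 4 / \<kappa> * inverse (N n / M n ^ 4)
      + 32 * s / (c0\<^sup>2 * \<kappa>) * (inverse (sqrt (N n) * t n))\<^sup>2
      = (4 * (k * M n) ^ 4 + 32 * s / (c0 * t n)\<^sup>2) / (N n * \<kappa>)" for n
  proof -
    have "(inverse (sqrt (N n) * t n))\<^sup>2 = inverse (N n * (t n)\<^sup>2)"
      using N[of n] by (simp add: power_mult_distrib power_inverse)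
    then show ?thesis
      by (simp add: power_mult_distrib divide_inverse distrib_left mult_ac)
  qed
  ultimately show ?thesis by simp
qed

section \<open>The probability of preferring the worse procedure\<close>

lemma (in prob_space) prob_conj_ge_of_pos:
  assumes "prob {\<omega> \<in> space M. P \<omega>} \<ge> 1 - a" "a < 1"
    and "prob {\<omega> \<in> space M. Q \<omega>} \<ge> 1 - b" "b < 1"
  shows "prob {\<omega> \<in> space M. P \<omega> \<and> Q \<omega>} \<ge> 1 - (a + b)"
proof (rule prob_conj_ge)
  \<comment> \<open>A positive measure forces measurability, since \<^const>\<open>measure\<close> is 0 on non-measurable sets.\<close>
  show "{\<omega> \<in> space M. P \<omega>} \<in> events" "{\<omega> \<in> space M. Q \<omega>} \<in> events"
    using assms measure_notin_sets[of "{\<omega> \<in> space M. P \<omega>}" M]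
      measure_notin_sets[of "{\<omega> \<in> space M. Q \<omega>}" M] by fastforce+
qed (use assms in auto)

context regression_model
begin

text \<open>Naming the procedures by quality, \<open>\<delta>a\<close> better and
  \<open>\<delta>b\<close> worse, serves both cases of the theorem. Ties count as preferring
  \<open>\<delta>b\<close>, so the event covers a wrong selection whichever way ties are
  resolved.\<close>

lemma prob_cv_prefers_worse_tendsto_0:
  fixes \<delta>a \<delta>b :: "(real ^ 'd) procedure" and pa pb A M :: "nat \<Rightarrow> real" and s :: real and n1 n2 :: "nat \<Rightarrow> nat"
  defines "La \<equiv> Lq_loss 2 PX f \<delta>a X Y" and "Lb \<equiv> Lq_loss 2 PX f \<delta>b X Y"
  assumes \<delta>: "regression_procedure \<X> \<delta>a" "regression_procedure \<X> \<delta>b"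
    and rates: "converges_exactly_at_rate \<P> La pa" "converges_exactly_at_rate \<P> Lb pb"
    and s: "0 \<le> s"
    and var: "\<And>i. 1 \<le> i \<Longrightarrow>
        AE \<omega> in \<P>. nn_cond_exp \<P> (vimage_algebra (space \<P>) (X i) (borel_on \<X>))
          (\<lambda>\<omega>. ennreal ((\<epsilon> i \<omega>)\<^sup>2)) \<omega> \<le> ennreal s"
    and A: "\<And>n. 1 \<le> n \<Longrightarrow> 0 < A n"
    and better: "asymptotically_better \<P> La Lb"
    and M: "\<And>n. 1 \<le> n \<Longrightarrow> 0 < M n"
      "bounded_in_prob \<P> (\<lambda>n \<omega>. Lq_loss 4 PX f \<delta>a X Y n \<omega> / La n \<omega>) M"
      "bounded_in_prob \<P> (\<lambda>n \<omega>. Lq_loss 4 PX f \<delta>b X Y n \<omega> / Lb n \<omega>) M"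
    and split: "\<And>n. n1 n + n2 n = n"
      "filterlim n1 at_top sequentially" "filterlim n2 at_top sequentially"
      "filterlim (\<lambda>n. real (n2 n) / M (n1 n) ^ 4) at_top sequentially"
      "filterlim (\<lambda>n. sqrt (real (n2 n)) * max (pa (n1 n)) (pb (n1 n)) / (1 + A (n1 n)))
        at_top sequentially"
  shows "(\<lambda>n. prob {\<omega> \<in> space \<P>. cv_criterion \<delta>b X Y (n1 n) n \<omega> \<le> cv_criterion \<delta>a X Y (n1 n) n \<omega>})
    \<longlonglongrightarrow> 0"
proof (rule LIMSEQ_I)
  fix r :: real assume "0 < r"
  \<comment> \<open>Seven events enter, each failing with probability at most \<open>e\<close>, so
    together they cost at most \<open>r / 2\<close>. The cap 1/2 keeps every partial sum of the
    \<open>e\<close> below 1, as combining the events requires.\<close>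
  define e where "e = min (r / 2) (1 / 2) / 7"
  have e: "0 < e" "e < 1" "7 * e < 1" "7 * e \<le> r / 2"
    using \<open>0 < r\<close> by (auto simp: e_def min_def)
  obtain c where c: "0 < c" and
    E1: "\<forall>\<^sub>F n in sequentially. prob {\<omega> \<in> space \<P>. Lb n \<omega> \<ge> ennreal (1 + c) * La n \<omega>} \<ge> 1 - e"
    using better e unfolding asymptotically_better_def by blast
  obtain ca where ca: "0 < ca" and
    E2: "\<forall>\<^sub>F n in sequentially. prob {\<omega> \<in> space \<P>. La n \<omega> \<ge> ennreal (ca * pa n)} \<ge> 1 - e"
    using rates(1) e unfolding converges_exactly_at_rate_def by blast
  obtain cb where cb: "0 < cb" and
    E3: "\<forall>\<^sub>F n in sequentially. prob {\<omega> \<in> space \<P>. Lb n \<omega> \<ge> ennreal (cb * pb n)} \<ge> 1 - e"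
    using rates(2) e unfolding converges_exactly_at_rate_def by blast
  \<comment> \<open>The upper bounds on the L2 losses make them finite, hence real numbers.\<close>
  obtain Ca where
    E4: "\<forall>\<^sub>F n in sequentially. prob {\<omega> \<in> space \<P>. La n \<omega> \<le> ennreal (Ca * pa n)} \<ge> 1 - e"
    using rates(1) e unfolding converges_exactly_at_rate_def bounded_in_prob_def by blast
  obtain Cb where
    E5: "\<forall>\<^sub>F n in sequentially. prob {\<omega> \<in> space \<P>. Lb n \<omega> \<le> ennreal (Cb * pb n)} \<ge> 1 - e"
    using rates(2) e unfolding converges_exactly_at_rate_def bounded_in_prob_def by blast
  obtain Ka where Ka: "0 < Ka" and
    E6: "\<forall>\<^sub>F n in sequentially. prob {\<omega> \<in> space \<P>. Lq_loss 4 PX f \<delta>a X Y n \<omega> / La n \<omega> \<le> ennreal (Ka * M n)} \<ge> 1 - e"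
    using M(2) e unfolding bounded_in_prob_def by blast
  obtain Kb where Kb: "0 < Kb" and
    E7: "\<forall>\<^sub>F n in sequentially. prob {\<omega> \<in> space \<P>. Lq_loss 4 PX f \<delta>b X Y n \<omega> / Lb n \<omega> \<le> ennreal (Kb * M n)} \<ge> 1 - e"
    using M(3) e unfolding bounded_in_prob_def by blast
  define k where "k = max Ka Kb"
  define c0 where "c0 = min ca cb"
  define \<kappa> where "\<kappa> = (1 - 1 / (1 + c)\<^sup>2)\<^sup>2"
  define L where "L q \<delta> m z = Lq_norm q PX (\<lambda>x. f x - \<delta> m z x)"
    for q and \<delta> :: "(real ^ 'd) procedure" and m z
  \<comment> \<open>The conjunction is nested to the left so that \<open>prob_conj_ge_of_pos\<close>
    peels off one condition at a time.\<close>
  define G where "G m z \<longleftrightarrow>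
      (((((ennreal (1 + c) * L 2 \<delta>a m z \<le> L 2 \<delta>b m z \<and>
      ennreal (ca * pa m) \<le> L 2 \<delta>a m z) \<and>
      ennreal (cb * pb m) \<le> L 2 \<delta>b m z) \<and>
      L 2 \<delta>a m z \<le> ennreal (Ca * pa m)) \<and>
      L 2 \<delta>b m z \<le> ennreal (Cb * pb m)) \<and>
      L 4 \<delta>a m z / L 2 \<delta>a m z \<le> ennreal (Ka * M m)) \<and>
      L 4 \<delta>b m z / L 2 \<delta>b m z \<le> ennreal (Kb * M m)" for m z
  define Z where "Z m \<omega> = (\<lambda>i\<in>{1..m}. (X i \<omega>, Y i \<omega>))" for m \<omega>
  define \<eta> where "\<eta> n = (4 * (k * M (n1 n)) ^ 4 + 32 * s / (c0 * max (pa (n1 n)) (pb (n1 n)))\<^sup>2)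
      / (real (n2 n) * \<kappa>)" for n
  have G_prob: "\<forall>\<^sub>F m in sequentially. prob {\<omega> \<in> space \<P>. G m (Z m \<omega>)} \<ge> 1 - 7 * e"
    using E1 E2 E3 E4 E5 E6 E7
  proof eventually_elim
    case (elim m)
    have "prob {\<omega> \<in> space \<P>. G m (Z m \<omega>)} \<ge> 1 - (e + e + e + e + e + e + e)"
      unfolding G_def Z_def L_def
      by (intro prob_conj_ge_of_pos elim[unfolded La_def Lb_def Lq_loss_def estimator_def]) (use e in auto)
    then show ?case by simp
  qed
  have n1_ev: "\<forall>\<^sub>F n in sequentially. 1 \<le> n1 n" and n2_ev: "\<forall>\<^sub>F n in sequentially. 1 \<le> n2 n"
    using split(2,3) unfolding filterlim_at_top by blast+
  have "\<eta> \<longlonglongrightarrow> 0"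
    unfolding \<eta>_def
    by (rule variance_bound_tendsto_0[OF split(4,5)]) (use n1_ev A in \<open>auto elim: eventually_mono\<close>)
  then have \<eta>_ev: "\<forall>\<^sub>F n in sequentially. \<eta> n < r / 2"
    using \<open>0 < r\<close> by (intro order_tendstoD(2)) auto
  \<comment> \<open>The bound in the sample size \<open>m\<close> is evaluated at
    \<open>n1 n\<close>, which tends to infinity.\<close>
  have G_ev: "\<forall>\<^sub>F n in sequentially. prob {\<omega> \<in> space \<P>. G (n1 n) (Z (n1 n) \<omega>)} \<ge> 1 - 7 * e"
    using eventually_compose_filterlim[OF G_prob split(2)] .
  have "\<forall>\<^sub>F n in sequentially.
      prob {\<omega> \<in> space \<P>. cv_criterion \<delta>b X Y (n1 n) n \<omega> \<le> cv_criterion \<delta>a X Y (n1 n) n \<omega>} < r"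
    using n1_ev n2_ev \<eta>_ev G_ev
  proof eventually_elim
    case (elim n)
    define m where "m = n1 n"
    define B where "B = {\<omega> \<in> space \<P>. cv_criterion \<delta>b X Y m n \<omega> \<le> cv_criterion \<delta>a X Y m n \<omega>}"
    have m: "1 \<le> m" using elim by (simp add: m_def)
    have p_pos: "0 < pa m" "0 < pb m"
      using rates m unfolding converges_exactly_at_rate_def by auto
    have Mm: "0 < M m" using M m by auto
    have c0: "0 < c0" "c0 \<le> ca" "c0 \<le> cb" and k: "0 < k" "Ka \<le> k" "Kb \<le> k"
      using ca cb Ka by (auto simp: c0_def k_def)
    have \<kappa>: "0 \<le> \<kappa>" unfolding \<kappa>_def by simp
    have \<eta>_nonneg: "0 \<le> \<eta> n"
      unfolding \<eta>_def using s \<kappa> by simp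
    let ?S = "\<Pi>\<^sub>M i\<in>{1..m}. borel_on \<X> \<Otimes>\<^sub>M (borel :: real measure)"
    have [measurable]: "(\<lambda>z. L q \<delta>' m z) \<in> borel_measurable ?S" if "\<delta>' \<in> {\<delta>a, \<delta>b}" for q \<delta>'
      unfolding L_def using measurable_Lq_norm_procedure[OF _ m] \<delta> that by blast
    have G_sets: "{z \<in> space ?S. G m z} \<in> sets ?S"
      unfolding G_def by (intro sets.sets_Collect_conj borel_measurable_le) measurable
    have fixed: "prob {\<omega> \<in> space \<P>. (\<Sum>i\<in>{m + 1..n}. (Y i \<omega> - \<delta>b m z (X i \<omega>))\<^sup>2)
        \<le> (\<Sum>i\<in>{m + 1..n}. (Y i \<omega> - \<delta>a m z (X i \<omega>))\<^sup>2)} \<le> \<eta> n"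
      if z: "z \<in> space ?S" and Gz: "G m z" for z
    proof -
      define ga where "ga x = f x - \<delta>a m z x" for x
      define gb where "gb x = f x - \<delta>b m z x" for x
      have G1: "ennreal (1 + c) * Lq_norm 2 PX ga \<le> Lq_norm 2 PX gb"
        and G2: "ennreal (ca * pa m) \<le> Lq_norm 2 PX ga" and G3: "ennreal (cb * pb m) \<le> Lq_norm 2 PX gb"
        and G4: "Lq_norm 2 PX ga \<le> ennreal (Ca * pa m)" and G5: "Lq_norm 2 PX gb \<le> ennreal (Cb * pb m)"
        and G6: "Lq_norm 4 PX ga / Lq_norm 2 PX ga \<le> ennreal (Ka * M m)"
        and G7: "Lq_norm 4 PX gb / Lq_norm 2 PX gb \<le> ennreal (Kb * M m)"
        using Gz unfolding G_def L_def ga_def gb_def by blast+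
      obtain ra where ra: "0 \<le> ra" "Lq_norm 2 PX ga = ennreal ra"
        using G4 by (cases "Lq_norm 2 PX ga") (auto simp: top_unique)
      obtain rb where rb: "0 \<le> rb" "Lq_norm 2 PX gb = ennreal rb"
        using G5 by (cases "Lq_norm 2 PX gb") (auto simp: top_unique)
      have ra_ge: "ca * pa m \<le> ra" and rb_ge: "cb * pb m \<le> rb"
        using G2 G3 ra rb by auto
      have ra_pos: "0 < ra" and rb_pos: "0 < rb"
        using ra_ge rb_ge mult_pos_pos[OF ca p_pos(1)] mult_pos_pos[OF cb p_pos(2)] by linarith+
      have rab: "(1 + c) * ra \<le> rb"
        using G1 rb(1) c unfolding ra(2) rb(2)
        by (metis add_nonneg_nonneg ennreal_le_iff ennreal_mult' less_imp_le zero_le_one)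
      have "ra \<le> (1 + c) * ra" using c ra_pos by simp
      with rab have "ra \<le> rb" by linarith
      \<comment> \<open>Since \<open>ra \<le> rb\<close>, the lower bound for \<open>ra\<close> at
        rate \<open>pa\<close> passes to \<open>rb\<close>; hence \<open>rb\<close> is bounded below
        by \<open>c0\<close> times the larger of the two rates.\<close>
      have "c0 * pa m \<le> rb" "c0 * pb m \<le> rb"
        using ra_ge rb_ge \<open>ra \<le> rb\<close> mult_right_mono[OF c0(2), of "pa m"] mult_right_mono[OF c0(3), of "pb m"]
          p_pos by linarith+
      then have t_le: "c0 * max (pa m) (pb m) \<le> rb"
        by (simp add: max_def)
      obtain ya where ya: "0 \<le> ya" "Lq_norm 4 PX ga = ennreal ya" "ya \<le> Ka * M m * ra"
        using ennreal_ratio_le_imp[OF G6[unfolded ra(2)] ra_pos] Ka Mm by auto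
      obtain yb where yb: "0 \<le> yb" "Lq_norm 4 PX gb = ennreal yb" "yb \<le> Kb * M m * rb"
        using ennreal_ratio_le_imp[OF G7[unfolded rb(2)] rb_pos] Kb Mm by auto
      have \<delta>z: "\<delta>' m z \<in> borel_measurable (borel_on \<X>)" if "regression_procedure \<X> \<delta>'" for \<delta>'
      proof -
        have "(\<lambda>(z, x). \<delta>' m z x) \<in> borel_measurable (?S \<Otimes>\<^sub>M borel_on \<X>)"
          using that m unfolding regression_procedure_def by blast
        from measurable_compose[OF measurable_Pair1'[OF z] this] show ?thesis by simp
      qed
      note [measurable] = measurable_f \<delta>z[OF \<delta>(1)] \<delta>z[OF \<delta>(2)]
      have [measurable]: "ga \<in> borel_measurable PX" "gb \<in> borel_measurable PX"
        unfolding ga_def gb_def by measurable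
      note a2 = Lq_norm_numeral[of "num.Bit0 num.One", OF ra(2,1) _ \<open>ga \<in> borel_measurable PX\<close>, simplified]
      note b2 = Lq_norm_numeral[of "num.Bit0 num.One", OF rb(2,1) _ \<open>gb \<in> borel_measurable PX\<close>, simplified]
      note a4 = Lq_norm_numeral[of "num.Bit0 (num.Bit0 num.One)", OF ya(2,1) _ \<open>ga \<in> borel_measurable PX\<close>, simplified]
      note b4 = Lq_norm_numeral[of "num.Bit0 (num.Bit0 num.One)", OF yb(2,1) _ \<open>gb \<in> borel_measurable PX\<close>, simplified]
      have "ya \<le> k * M m * ra" "yb \<le> k * M m * rb"
        using ya(3) yb(3) k Mm ra_pos rb_pos
        by (auto intro: order_trans[OF _ mult_right_mono[OF mult_right_mono]])
      then have F: "ya ^ 4 \<le> (k * M m * ra) ^ 4" "yb ^ 4 \<le> (k * M m * rb) ^ 4"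
        using ya(1) yb(1) by (auto intro: power_mono)
      have card: "card {m + 1..n} = n2 n" using split(1)[of n] by (simp add: m_def)
      have N: "0 < real (n2 n)" using elim by simp
      note bound = variance_bound_over_gap_le[OF ra_pos rab t_le _ c _ s N F]
      have J: "{m + 1..n} \<noteq> {}" "{m + 1..n} \<subseteq> {1..}"
        using card N by (metis card.empty less_irrefl of_nat_0) auto
      have k4: "0 < c0 * max (pa m) (pb m)" "0 \<le> k * M m"
        using c0 k Mm p_pos by (auto simp: less_max_iff_disj)
      have less: "(\<integral>x. (f x - \<delta>a m z x)\<^sup>2 \<partial>PX) < (\<integral>x. (f x - \<delta>b m z x)\<^sup>2 \<partial>PX)"
        unfolding a2(2)[unfolded ga_def] b2(2)[unfolded gb_def] by (rule bound(1)[OF k4])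
      have "prob {\<omega> \<in> space \<P>. (\<Sum>i\<in>{m + 1..n}. (Y i \<omega> - \<delta>b m z (X i \<omega>))\<^sup>2)
          \<le> (\<Sum>i\<in>{m + 1..n}. (Y i \<omega> - \<delta>a m z (X i \<omega>))\<^sup>2)}
        \<le> (2 * (ya ^ 4 + yb ^ 4) + 16 * s * (ra\<^sup>2 + rb\<^sup>2)) / (real (n2 n) * (rb\<^sup>2 - ra\<^sup>2)\<^sup>2)"
        using prob_fixed_estimates_le[OF finite_atLeastAtMost J s var \<delta>z[OF \<delta>(1)] \<delta>z[OF \<delta>(2)]
          a2(1)[unfolded ga_def] a4(1)[unfolded ga_def] b2(1)[unfolded gb_def] b4(1)[unfolded gb_def] less]
        unfolding card a2(2)[unfolded ga_def] b2(2)[unfolded gb_def] a4(2)[unfolded ga_def] b4(2)[unfolded gb_def]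
        by simp
      also have "\<dots> \<le> \<eta> n"
        unfolding \<eta>_def \<kappa>_def m_def[symmetric] by (rule bound(2)[OF k4])
      finally show ?thesis .
    qed
    have bad: "prob {\<omega> \<in> space \<P>. G m (Z m \<omega>) \<and>
        cv_criterion \<delta>b X Y m n \<omega> \<le> cv_criterion \<delta>a X Y m n \<omega>} \<le> \<eta> n"
      unfolding Z_def by (rule prob_cv_criterion_le[OF \<delta> m G_sets \<eta>_nonneg fixed])
    have B: "B \<in> events"
      unfolding B_def by (intro borel_measurable_le measurable_cv_criterion \<delta> m)
    let ?H = "{\<omega> \<in> space \<P>. G m (Z m \<omega>)}"
    have GP: "1 - 7 * e \<le> prob ?H" using elim by (simp add: m_def)
    \<comment> \<open>Non-measurable sets have \<open>measure\<close> 0, so the positive lower bound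
      makes \<open>?H\<close> an event.\<close>
    then have H: "?H \<in> events" using e measure_notin_sets[of ?H \<P>] by fastforce
    \<comment> \<open>Writing \<open>prob B\<close> as \<open>1 - (1 - prob B)\<close> turns the
      intersection bound into an upper bound for \<open>prob B\<close>: the part inside
      \<open>?H\<close> plus \<open>7 * e\<close>.\<close>
    have "prob {\<omega> \<in> space \<P>. \<omega> \<in> ?H \<and> \<omega> \<in> B} \<ge> 1 - (7 * e + (1 - prob B))"
      using GP B H by (intro prob_conj_ge) (auto simp: B_def)
    also have "{\<omega> \<in> space \<P>. \<omega> \<in> ?H \<and> \<omega> \<in> B} = {\<omega> \<in> space \<P>. G m (Z m \<omega>) \<and>
        cv_criterion \<delta>b X Y m n \<omega> \<le> cv_criterion \<delta>a X Y m n \<omega>}"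
      by (auto simp: B_def)
    finally have "prob B \<le> 7 * e + \<eta> n" using bad by linarith
    also have "\<dots> < r" using elim e by linarith
    finally show ?case unfolding B_def m_def .
  qed
  then show "\<exists>n0. \<forall>n\<ge>n0. norm (prob {\<omega> \<in> space \<P>. cv_criterion \<delta>b X Y (n1 n) n \<omega>
      \<le> cv_criterion \<delta>a X Y (n1 n) n \<omega>} - 0) < r"
    by (simp add: eventually_sequentially)
qed

end

section \<open>Consistency of the selection\<close>

theorem theorem1:
  fixes \<P> :: "'w measure"
    and \<X> :: "(real ^ 'd) set"
    and PX :: "(real ^ 'd) measure"
    and X :: "nat \<Rightarrow> 'w \<Rightarrow> real ^ 'd"
    and Y \<epsilon> :: "nat \<Rightarrow> 'w \<Rightarrow> real"
    and f :: "real ^ 'd \<Rightarrow> real"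
    and \<delta>1 \<delta>2 :: "(real ^ 'd) procedure"
    and p q A M :: "nat \<Rightarrow> real"
    and \<sigma>2 :: real
    and n1 n2 :: "nat \<Rightarrow> nat"
  assumes model: "regression_model \<P> \<X> PX X Y \<epsilon> f"
    and procedures: "regression_procedure \<X> \<delta>1" "regression_procedure \<X> \<delta>2"
    and exact_rates:
      "converges_exactly_at_rate \<P> (Lq_loss 2 PX f \<delta>1 X Y) p"
      "converges_exactly_at_rate \<P> (Lq_loss 2 PX f \<delta>2 X Y) q"
    and error_variances: "0 < \<sigma>2"
      "\<And>i. 1 \<le> i \<Longrightarrow>
        AE \<omega> in \<P>. nn_cond_exp \<P> (vimage_algebra (space \<P>) (X i) (borel_on \<X>))
          (\<lambda>\<omega>. ennreal ((\<epsilon> i \<omega>)\<^sup>2)) \<omega> \<le> ennreal \<sigma>2"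
    and sup_norms: "\<And>n. 1 \<le> n \<Longrightarrow> 0 < A n"
      "\<And>\<delta>. \<delta> \<in> {\<delta>1, \<delta>2} \<Longrightarrow> bounded_in_prob \<P> (Linf_loss PX f \<delta> X Y) A"
    and one_better:
      "asymptotically_better \<P> (Lq_loss 2 PX f \<delta>1 X Y) (Lq_loss 2 PX f \<delta>2 X Y) \<or>
       asymptotically_better \<P> (Lq_loss 2 PX f \<delta>2 X Y) (Lq_loss 2 PX f \<delta>1 X Y)"
    and norm_ratios: "\<And>n. 1 \<le> n \<Longrightarrow> 0 < M n"
      "\<And>\<delta>. \<delta> \<in> {\<delta>1, \<delta>2} \<Longrightarrow>
        bounded_in_prob \<P> (\<lambda>n \<omega>. Lq_loss 4 PX f \<delta> X Y n \<omega> / Lq_loss 2 PX f \<delta> X Y n \<omega>) M"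
    and splitting: "\<And>n. n1 n + n2 n = n"
      "filterlim n1 at_top sequentially"
      "filterlim n2 at_top sequentially"
      "filterlim (\<lambda>n. real (n2 n) / M (n1 n) ^ 4) at_top sequentially"
      "filterlim (\<lambda>n. sqrt (real (n2 n)) * max (p (n1 n)) (q (n1 n)) / (1 + A (n1 n)))
        at_top sequentially"
  shows "(\<lambda>n. measure \<P> {\<omega> \<in> space \<P>. cv_selection \<delta>1 \<delta>2 X Y (n1 n) n \<omega> \<noteq>
      better_procedure \<P> (Lq_loss 2 PX f \<delta>1 X Y) (Lq_loss 2 PX f \<delta>2 X Y)}) \<longlonglongrightarrow> 0"
proof -
  interpret regression_model \<P> \<X> PX X Y \<epsilon> f by (rule model)
  let ?L = "\<lambda>\<delta>. Lq_loss 2 PX f \<delta> X Y" and ?CV = "\<lambda>\<delta> n. cv_criterion \<delta> X Y (n1 n) n"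
  have \<sigma>2: "0 \<le> \<sigma>2" using error_variances(1) by simp
  have n1_ev: "\<forall>\<^sub>F n in sequentially. 1 \<le> n1 n"
    using splitting(2) unfolding filterlim_at_top by blast
  note ratios = norm_ratios(2)[of \<delta>1] norm_ratios(2)[of \<delta>2]
  \<comment> \<open>The case split follows the order of the branches of
    \<open>better_procedure\<close>, so its value is determined in each case.\<close>
  show ?thesis
  proof (cases "asymptotically_better \<P> (?L \<delta>1) (?L \<delta>2)")
    case True
    have lim: "(\<lambda>n. prob {\<omega> \<in> space \<P>. ?CV \<delta>2 n \<omega> \<le> ?CV \<delta>1 n \<omega>}) \<longlonglongrightarrow> 0"
      by (rule prob_cv_prefers_worse_tendsto_0[OF procedures exact_rates \<sigma>2 error_variances(2)
            sup_norms(1) True norm_ratios(1) _ _ splitting]) (use ratios in auto)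
    \<comment> \<open>When \<open>\<delta>1\<close> is better, a wrong selection means a strictly
      smaller criterion for \<open>\<delta>2\<close>, an event contained in the one of
      \<open>lim\<close>. Monotonicity of the measure needs the larger set to be measurable, which
      holds once \<open>n1 n\<close> is at least 1.\<close>
    show ?thesis
    proof (rule tendsto_sandwich[OF _ _ tendsto_const lim])
      show "\<forall>\<^sub>F n in sequentially. prob {\<omega> \<in> space \<P>. cv_selection \<delta>1 \<delta>2 X Y (n1 n) n \<omega> \<noteq>
          better_procedure \<P> (?L \<delta>1) (?L \<delta>2)} \<le> prob {\<omega> \<in> space \<P>. ?CV \<delta>2 n \<omega> \<le> ?CV \<delta>1 n \<omega>}"
        using n1_ev
      proof eventually_elim
        case (elim n)
        note [measurable] = procedures[THEN measurable_cv_criterion[OF _ elim]]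
        show ?case
          by (intro finite_measure_mono)
            (use True in \<open>auto simp: better_procedure_def cv_selection_def split: if_splits\<close>)
      qed
    qed simp
  next
    case False
    with one_better have better: "asymptotically_better \<P> (?L \<delta>2) (?L \<delta>1)" by blast
    \<comment> \<open>The roles of the procedures and of their rates are exchanged; the last
      splitting condition is symmetric in the two rates.\<close>
    have lim: "(\<lambda>n. prob {\<omega> \<in> space \<P>. ?CV \<delta>1 n \<omega> \<le> ?CV \<delta>2 n \<omega>}) \<longlonglongrightarrow> 0"
      by (rule prob_cv_prefers_worse_tendsto_0[OF procedures(2,1) exact_rates(2,1) \<sigma>2 error_variances(2)
            sup_norms(1) better norm_ratios(1) _ _ splitting(1-4)])
        (use ratios splitting(5) in \<open>auto simp: max.commute\<close>)
    \<comment> \<open>A tie selects 1, so here the wrong selection is exactly the event of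
      \<open>lim\<close>.\<close>
    have "{\<omega> \<in> space \<P>. cv_selection \<delta>1 \<delta>2 X Y (n1 n) n \<omega> \<noteq> better_procedure \<P> (?L \<delta>1) (?L \<delta>2)}
        = {\<omega> \<in> space \<P>. ?CV \<delta>1 n \<omega> \<le> ?CV \<delta>2 n \<omega>}" for n
      using False better by (auto simp: better_procedure_def cv_selection_def)
    with lim show ?thesis by simp
  qed
qed

end
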